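(* Let $\mathcal{X}$, $\mathcal{Y}$ and $\mathcal{Z}$ be subspaces of $\mathcal{H}$ with $\dim \mathcal{X} = \dim \mathcal{Y}$. Then $$|\cos^2\Theta(\mathcal{X},\mathcal{Z})-\cos^2\Theta(\mathcal{Y},\mathcal{Z})| = |\sin^2\Theta(\mathcal{X},\mathcal{Z})-\sin^2\Theta(\mathcal{Y},\mathcal{Z})| \prec_w \sin\Theta(\mathcal{X},\mathcal{Y}).$$
   Context: $\mathcal{H}$ is a real or complex vector space of finite dimension $n$ equipped with an inner product. $P_{\mathcal{X}}$ denotes the orthogonal projector onto a subspace $\mathcal{X}$ of $\mathcal{H}$. For an operator $A:\mathcal{H}\to\mathcal{H}$, $s_1(A)\ge s_2(A)\ge\cdots$ are its singular values in nonincreasing order. Principal angles: for subspaces $\mathcal{X},\mathcal{Y}$ of $\mathcal{H}$ let $m=\min\{\dim\mathcal{X},\dim\mathcal{Y}\}$. The vector of principal angles $\Theta(\mathcal{X},\mathcal{Y})=[\theta_1,\ldots,\theta_m]$, $\theta_i\in[0,\pi/2]$, in nondecreasing order, is defined by $\cos\Theta(\mathcal{X},\mathcal{Y})=[s_1(P_{\mathcal{X}}P_{\mathcal{Y}}),\ldots,s_m(P_{\mathcal{X}}P_{\mathcal{Y}})]$. Functions of $\Theta$ (such as $\sin$, $\sin^2$, $\cos^2$) and the absolute value $|\cdot|$ of a vector are applied componentwise, and differences are taken componentwise (with the components in the given order). Weak majorization: for a real vector $x=[x_1,\ldots,x_n]$, $x^\downarrow$ is the vector obtained by rearranging the entries of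 $x$ in nonincreasing order. For real vectors $x,y$ of length $n$, $x\prec_w y$ means $\sum_{i=1}^k x_i^\downarrow\le\sum_{i=1}^k y_i^\downarrow$ for all $k=1,\ldots,n$. Vectors of different lengths are compared by appending zeros to the shorter one to make the lengths equal. *)

theory Defs
  imports Complex_Main "Jordan_Normal_Form.Conjugate"
begin

text \<open>
  The scalar fields: up to isomorphism, the reals with the identity as conjugation and the
  complex numbers with the usual conjugation are the only members of this class
  (lemma \<open>real_or_complex_cases\<close>), so quantifying over it is quantifying over these two fields.
\<close>

class real_or_complex = conjugatable_field + real_field +
  assumes conjugate_eq_self_iff: "conjugate z = z \<longleftrightarrow> (\<exists>r. z = r *\<^sub>R 1)"
    and mult_conjugate_nonneg: "\<exists>r\<ge>0. z * conjugate z = r *\<^sub>R 1"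

instance real :: real_or_complex
proof
  fix z :: real
  show "conjugate z = z \<longleftrightarrow> (\<exists>r. z = r *\<^sub>R 1)"
    by simp
  show "\<exists>r\<ge>0. z * conjugate z = r *\<^sub>R 1"
    by (intro exI[of _ "z * z"]) simp
qed

instance complex :: real_or_complex
proof
  fix z :: complex
  show "conjugate z = z \<longleftrightarrow> (\<exists>r. z = r *\<^sub>R 1)"
    by (auto simp: complex_eq_iff)
  show "\<exists>r\<ge>0. z * conjugate z = r *\<^sub>R 1"
    by (intro exI[of _ "(cmod z)\<^sup>2"]) (simp add: complex_eq_iff cmod_power2, simp add: power2_eq_square)
qed

lemma real_or_complex_cases:
  obtains (real) "range (of_real :: real \<Rightarrow> 'k::real_or_complex) = UNIV"
      "\<And>z :: 'k::real_or_complex. conjugate z = z"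
  | (complex) \<phi> :: "complex \<Rightarrow> 'k::real_or_complex" where "bij \<phi>"
      "\<And>x y. \<phi> (x + y) = \<phi> x + \<phi> y" "\<And>x y. \<phi> (x * y) = \<phi> x * \<phi> y"
      "\<And>r. \<phi> (complex_of_real r) = of_real r" "\<And>x. \<phi> (cnj x) = conjugate (\<phi> x)"
proof (cases "\<forall>z :: 'k. conjugate z = z")
  case True
  then show ?thesis
    using real by (metis UNIV_eq_I conjugate_eq_self_iff of_real_def rangeI)
next
  case False
  then obtain z :: 'k where z: "conjugate z \<noteq> z" by blast
  have cd: "conjugate (a - b) = conjugate a - conjugate b" for a b :: 'k
    using conjugate_dist_add[of a "- b"] by (simp add: conjugate_neg)
  have cr: "conjugate (of_real r) = (of_real r :: 'k)" for r
    by (auto simp: conjugate_eq_self_iff of_real_def)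
  define w where "w = z - conjugate z"
  have w0: "w \<noteq> 0" and cw: "conjugate w = - w"
    using z by (auto simp: w_def cd)
  obtain r where r: "r \<ge> 0" "w * conjugate w = of_real r"
    using mult_conjugate_nonneg by (auto simp: of_real_def)
  then have ww: "w * w = - of_real r"
    using cw by (simp add: minus_equation_iff[of "w * w"])
  then have r0: "r > 0"
    using w0 r(1) by (cases "r = 0") auto
  define i where "i = w * of_real (1 / sqrt r)"
  have "of_real (1 / sqrt r) * of_real (1 / sqrt r) = (of_real (1 / r) :: 'k)"
    using r0 by (simp flip: of_real_mult)
  then have "i * i = - of_real r * of_real (1 / r)"
    unfolding i_def ww[symmetric] by (metis mult.assoc mult.left_commute)
  then have ii: "i * i = - 1"
    using r0 by simp
  have ci: "conjugate i = - i"
    by (simp only: i_def conjugate_dist_mul cw cr) simp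
  define \<phi> where "\<phi> c = of_real (Re c) + of_real (Im c) * i" for c
  show ?thesis
  proof (rule complex[of \<phi>])
    show "\<phi> (x + y) = \<phi> x + \<phi> y" for x y
      by (simp add: \<phi>_def algebra_simps)
    have iia: "i * (i * a) = - a" for a
      using ii by (simp flip: mult.assoc)
    show "\<phi> (x * y) = \<phi> x * \<phi> y" for x y
      by (simp add: \<phi>_def algebra_simps ii iia)
    show "\<phi> (complex_of_real r) = of_real r" for r
      by (simp add: \<phi>_def)
    show conj: "\<phi> (cnj x) = conjugate (\<phi> x)" for x
      by (simp add: \<phi>_def conjugate_dist_add conjugate_dist_mul cr ci)
    show "bij \<phi>"
    proof (rule bijI)
      show "inj \<phi>"
      proof (rule injI)
        fix x y assume eq: "\<phi> x = \<phi> y"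
        then have "\<phi> (cnj x) = \<phi> (cnj y)" by (simp add: conj)
        with eq have "\<phi> x + \<phi> (cnj x) = \<phi> y + \<phi> (cnj y)" by simp
        then have "(of_real (2 * Re x) :: 'k) = of_real (2 * Re y)"
          by (simp add: \<phi>_def)
        then have re: "Re x = Re y" by (simp only: of_real_eq_iff)
        then have "of_real (Im x) * i = of_real (Im y) * i"
          using eq by (simp add: \<phi>_def)
        moreover have "i \<noteq> 0" using ii by auto
        ultimately have "Im x = Im y" by simp
        with re show "x = y" by (simp add: complex_eq_iff)
      qed
      have "\<exists>c. u = \<phi> c" for u
      proof -
        define a b where "a = (u + conjugate u) / 2" and "b = (conjugate u - u) * i / 2"
        have half: "conjugate (x / 2) = conjugate x / 2" for x :: 'k
          using cr[of "1 / 2"] conjugate_dist_mul[of x "of_real (1 / 2)"] by simp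
        have "conjugate a = a"
          by (simp add: a_def half conjugate_dist_add add.commute)
        then obtain a' where a': "a = of_real a'"
          by (auto simp: conjugate_eq_self_iff of_real_def)
        have "conjugate b = b"
          by (simp add: b_def half conjugate_dist_mul cd ci algebra_simps)
        then obtain b' where b': "b = of_real b'"
          by (auto simp: conjugate_eq_self_iff of_real_def)
        have "b * i = (conjugate u - u) * (i * i) / 2"
          by (simp add: b_def)
        then have "a + b * i = u"
          by (simp add: a_def ii field_simps)
        then show ?thesis
          by (intro exI[of _ "Complex a' b'"]) (simp add: \<phi>_def a' b')
      qed
      then show "surj \<phi>" by (auto simp: surj_def)
    qed
  qed
qed

locale fin_dim_inner_product_space = vector_space scale
  for scale :: "'k::real_or_complex \<Rightarrow> 'v::ab_group_add \<Rightarrow> 'v" +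
  fixes ip :: "'v \<Rightarrow> 'v \<Rightarrow> 'k"
  assumes fin_dim: "\<exists>B. finite B \<and> span B = UNIV"
    and ip_add_left: "ip (x + y) z = ip x z + ip y z"
    and ip_scale_left: "ip (scale c x) z = c * ip x z"
    and ip_conjugate: "ip y x = conjugate (ip x y)"
    and ip_positive: "x \<noteq> 0 \<Longrightarrow> \<exists>r>0. ip x x = of_real r"
begin

definition orth_proj :: "'v set \<Rightarrow> 'v \<Rightarrow> 'v" where
  "orth_proj X v = (THE w. w \<in> X \<and> (\<forall>x\<in>X. ip (v - w) x = 0))"

definition adjoint :: "('v \<Rightarrow> 'v) \<Rightarrow> 'v \<Rightarrow> 'v" where
  "adjoint A = (THE B. \<forall>x y. ip (A x) y = ip x (B y))"

definition eigenspace :: "('v \<Rightarrow> 'v) \<Rightarrow> 'k \<Rightarrow> 'v set" where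
  "eigenspace A c = {v. A v = scale c v}"

text \<open>
  The nonincreasing list of the square roots of the eigenvalues of \<open>A\<^sup>* A\<close>, each repeated according
  to its multiplicity; as \<open>A\<^sup>* A\<close> is self-adjoint, this is the dimension of the eigenspace.
  The list is indexed from 0, so the singular value \<open>s\<^sub>i\<close> is at position \<open>i - 1\<close>.
\<close>

definition singular_values :: "('v \<Rightarrow> 'v) \<Rightarrow> real list" where
  "singular_values A = (THE s. sorted_wrt (\<ge>) s \<and> set s \<subseteq> {0..} \<and>
     (\<forall>\<sigma>\<ge>0. count_list s \<sigma> = dim (eigenspace (adjoint A \<circ> A) (of_real (\<sigma>\<^sup>2)))))"

definition principal_angles :: "'v set \<Rightarrow> 'v set \<Rightarrow> real list" where
  "principal_angles X Y =
     map arccos (take (min (dim X) (dim Y)) (singular_values (orth_proj X \<circ> orth_proj Y)))"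

end

definition pad_zeros :: "nat \<Rightarrow> real list \<Rightarrow> real list" where
  "pad_zeros n x = x @ replicate (n - length x) 0"

definition nonincreasing :: "real list \<Rightarrow> real list" where
  "nonincreasing x = rev (sort x)"

definition weakly_majorized :: "real list \<Rightarrow> real list \<Rightarrow> bool"  (infix "\<prec>\<^sub>w" 50) where
  "x \<prec>\<^sub>w y \<longleftrightarrow> (let n = max (length x) (length y) in
     \<forall>k\<in>{1..n}. sum_list (take k (nonincreasing (pad_zeros n x)))
              \<le> sum_list (take k (nonincreasing (pad_zeros n y))))"

definition abs_diff :: "real list \<Rightarrow> real list \<Rightarrow> real list" where
  "abs_diff x y = map2 (\<lambda>a b. \<bar>a - b\<bar>) x y"

end

theory Submission
  imports Defs "HOL-Combinatorics.Permutations"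
    "HOL-Computational_Algebra.Fundamental_Theorem_Algebra"
begin

text \<open>
  Write \<open>P\<close>, \<open>R\<close>, \<open>Q\<close> for the projectors onto \<open>X\<close>, \<open>Y\<close>, \<open>Z\<close>.  The numbers \<open>cos\<^sup>2 \<theta>\<^sub>i(X, Z)\<close> are the
  largest eigenvalues of \<open>Q P Q\<close>, and \<open>sin\<^sup>2 \<theta>\<^sub>i(X, Z)\<close> occur as eigenvalues of
  \<open>(1 - Q) P (1 - Q)\<close>.  Applying Lidskii's inequality to \<open>Q (P - R) Q\<close> alone would only give the bound with
  each \<open>sin \<theta>\<^sub>i(X, Y)\<close> counted twice, because \<open>P - R\<close> has the eigenvalues \<open>\<plusminus> sin \<theta>\<^sub>i(X, Y)\<close>.
  Instead, the indices where the squared cosine increases are treated with \<open>Q\<close> and those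
  where it decreases with \<open>1 - Q\<close>.  For every \<open>t \<ge> 0\<close> both sums are controlled by the
  positive part \<open>G\<close> of \<open>P - R - t\<close>, and \<open>tr (Q G Q) + tr ((1 - Q) G (1 - Q)) = tr G\<close>.
\<close>

section \<open>Real parts in an abstract real or complex field\<close>

text \<open>The eigenvalues of \<open>Q P Q\<close> and \<open>(1 - Q) P (1 - Q)\<close> belong to
  operators with different ranges. They are linked through \<open>X\<close>: there
  \<open>P (1 - Q) P\<close> is the identity minus \<open>P Q P\<close>, so one eigenbasis serves
  both, with eigenvalues \<open>a i\<close> and \<open>1 - a i\<close>, and nonzero eigenvalues
  survive the exchange of the two projectors. Passing to \<open>1 - Q\<close> turns a decrease of
  the squared cosine into an increase. Both cases thus need only an upper bound for
  \<open>P - R\<close>, and its negative eigenvalues, the second copy of the sines, never enter.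
  Equal dimensions give both lists the same length, so reversing them to restore the nonincreasing
  order still pairs equal indices. The parameter \<open>t\<close> removes the sorting from
  majorization: one inequality for all index sets and all t >= 0 is enough, and it is linear in the
  quadratic forms. The scalars may be real, so an eigenvector cannot be taken from a root in the
  scalar field; it comes from a real polynomial annihilating a vector, whose irreducible quadratic
  factors are harmless for self-adjoint operators.\<close>

lemma conjugate_of_real [simp]: "conjugate (of_real r :: 'k::real_or_complex) = of_real r"
  by (auto simp: conjugate_eq_self_iff of_real_def)

lemma conjugate_eq_self_imp_of_real:
  assumes "conjugate (z :: 'k::real_or_complex) = z"
  obtains r where "z = of_real r"
  using assms by (auto simp: conjugate_eq_self_iff of_real_def)

text \<open>The scalar field is abstract and has no \<open>Re\<close>. Conjugation fixes
  \<open>z + conjugate z\<close>, so that sum is real, and half of it is the real part in both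
  fields.\<close>

definition real_part :: "'k::real_or_complex \<Rightarrow> real" where
  "real_part z = (THE r. z + conjugate z = of_real (2 * r))"

lemma add_conjugate: "z + conjugate z = of_real (2 * real_part z)"
proof -
  obtain r where r: "z + conjugate z = of_real r"
    by (rule conjugate_eq_self_imp_of_real[of "z + conjugate z"])
      (simp add: conjugate_dist_add add.commute)
  have "\<exists>!r. z + conjugate z = of_real (2 * r)"
    unfolding r of_real_eq_iff by (rule ex1I[of _ "r / 2"]) simp_all
  then show ?thesis
    unfolding real_part_def by (rule theI')
qed

lemma real_part_eqI: "z + conjugate z = of_real (2 * r) \<Longrightarrow> real_part z = r"
  unfolding add_conjugate of_real_eq_iff by simp

lemma real_part_of_real [simp]: "real_part (of_real r) = r"
  by (rule real_part_eqI) simp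

lemma real_part_0 [simp]: "real_part 0 = 0"
  using real_part_of_real[of 0] by simp

lemma real_part_1 [simp]: "real_part 1 = 1"
  using real_part_of_real[of 1] by simp

lemma real_part_add: "real_part (x + y) = real_part x + real_part y"
proof (rule real_part_eqI)
  have "x + y + conjugate (x + y) = (x + conjugate x) + (y + conjugate y)"
    by (simp add: conjugate_dist_add ac_simps)
  then show "x + y + conjugate (x + y) = of_real (2 * (real_part x + real_part y))"
    by (simp only: add_conjugate) (simp add: distrib_left)
qed

lemma real_part_minus [simp]: "real_part (- x) = - real_part x"
  using real_part_add[of x "- x"] by simp

lemma real_part_diff: "real_part (x - y) = real_part x - real_part y"
  using real_part_add[of x "- y"] by simp

lemma real_part_sum: "real_part (sum f A) = (\<Sum>i\<in>A. real_part (f i))"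
  by (induction A rule: infinite_finite_induct) (simp_all add: real_part_add)

lemma real_part_of_real_mult [simp]: "real_part (of_real r * x) = r * real_part x"
proof (rule real_part_eqI)
  have "of_real r * x + conjugate (of_real r * x) = of_real r * (x + conjugate x)"
    by (simp add: conjugate_dist_mul distrib_left)
  then show "of_real r * x + conjugate (of_real r * x) = of_real (2 * (r * real_part x))"
    by (simp only: add_conjugate) (simp add: ac_simps)
qed

lemma conjugate_diff: "conjugate (a - b) = conjugate a - conjugate (b :: 'k::real_or_complex)"
  using conjugate_dist_add[of a "- b"] by (simp add: conjugate_neg)

definition abs_square :: "'k::real_or_complex \<Rightarrow> real" where
  "abs_square z = real_part (z * conjugate z)"

lemma mult_conjugate: "z * conjugate z = of_real (abs_square z)"
  and abs_square_nonneg [simp]: "abs_square z \<ge> 0"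
proof -
  obtain r where r: "r \<ge> 0" "z * conjugate z = of_real r"
    using mult_conjugate_nonneg[of z] by (auto simp: of_real_def)
  then show "z * conjugate z = of_real (abs_square z)" "abs_square z \<ge> 0"
    by (simp_all add: abs_square_def)
qed

lemma abs_square_0 [simp]: "abs_square 0 = 0"
  by (simp add: abs_square_def)

lemma abs_square_of_real: "abs_square (of_real r) = r\<^sup>2"
  by (simp add: abs_square_def power2_eq_square)

lemma abs_square_conjugate: "abs_square (conjugate z) = abs_square z"
  by (simp add: abs_square_def mult.commute)

section \<open>Orthonormal bases\<close>

context fin_dim_inner_product_space
begin

text \<open>A basis chosen once and for all: the locale
  \<open>finite_dimensional_vector_space\<close> takes one as a parameter, whereas
  \<open>fin_dim\<close> only asserts that a finite spanning set exists.\<close>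

definition hbasis :: "'v set" where
  "hbasis = (SOME B. finite B \<and> independent B \<and> span B = UNIV)"

lemma hbasis: "finite hbasis" "independent hbasis" "span hbasis = UNIV"
proof -
  obtain B where B: "finite B" "span B = UNIV"
    using fin_dim by blast
  obtain C where C: "C \<subseteq> B" "independent C" "B \<subseteq> span C"
    using maximal_independent_subset[of B] by blast
  have "span C = UNIV"
    using span_mono[OF C(3)] B(2) by (auto simp: span_span)
  then have "\<exists>B. finite B \<and> independent B \<and> span B = UNIV"
    using C(2) finite_subset[OF C(1) B(1)] by (intro exI[of _ C] conjI)
  then have "finite hbasis \<and> independent hbasis \<and> span hbasis = UNIV"
    unfolding hbasis_def by (rule someI_ex)
  then show "finite hbasis" "independent hbasis" "span hbasis = UNIV"
    by auto
qed

sublocale finite_dimensional_vector_space scale hbasis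
  by unfold_locales (use hbasis in auto)

lemma ip_0_left [simp]: "ip 0 y = 0"
  using ip_scale_left[of 0 0 y] by simp

lemma ip_0_right [simp]: "ip x 0 = 0"
  using ip_conjugate[of x 0] by simp

lemma ip_add_right: "ip x (y + z) = ip x y + ip x z"
  by (metis ip_conjugate ip_add_left conjugate_dist_add)

lemma ip_scale_right: "ip x (scale c y) = conjugate c * ip x y"
  by (metis ip_conjugate ip_scale_left conjugate_dist_mul)

lemma ip_minus_left: "ip (- x) y = - ip x y"
  using ip_add_left[of "- x" x y] by (simp add: eq_neg_iff_add_eq_0)

lemma ip_minus_right: "ip x (- y) = - ip x y"
  using ip_add_right[of x "- y" y] by (simp add: eq_neg_iff_add_eq_0)

lemma ip_diff_left: "ip (x - y) z = ip x z - ip y z"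
  using ip_add_left[of x "- y" z] by (simp add: ip_minus_left)

lemma ip_diff_right: "ip z (x - y) = ip z x - ip z y"
  using ip_add_right[of z x "- y"] by (simp add: ip_minus_right)

lemma ip_sum_left: "ip (sum f A) y = (\<Sum>i\<in>A. ip (f i) y)"
  by (induction A rule: infinite_finite_induct) (simp_all add: ip_add_left)

lemma ip_sum_right: "ip y (sum f A) = (\<Sum>i\<in>A. ip y (f i))"
  by (induction A rule: infinite_finite_induct) (simp_all add: ip_add_right)

lemmas ip_simps = ip_add_left ip_add_right ip_diff_left ip_diff_right ip_scale_left ip_scale_right
  ip_minus_left ip_minus_right ip_sum_left ip_sum_right

definition norm_square :: "'v \<Rightarrow> real" where
  "norm_square x = real_part (ip x x)"

lemma ip_self: "ip x x = of_real (norm_square x)"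
  and norm_square_nonneg [simp]: "norm_square x \<ge> 0"
proof -
  have "\<exists>r\<ge>0. ip x x = of_real r"
  proof (cases "x = 0")
    case True
    then show ?thesis by (intro exI[of _ 0]) simp
  next
    case False
    then show ?thesis using ip_positive[of x] by (auto intro: less_imp_le)
  qed
  then show "ip x x = of_real (norm_square x)" "norm_square x \<ge> 0"
    by (auto simp: norm_square_def)
qed

lemma ip_self_eq_0_iff [simp]: "ip x x = 0 \<longleftrightarrow> x = 0"
  using ip_positive[of x] by (cases "x = 0") auto

lemma norm_square_eq_0_iff [simp]: "norm_square x = 0 \<longleftrightarrow> x = 0"
  using ip_self[of x] ip_self_eq_0_iff[of x] by (metis of_real_eq_0_iff)

lemma norm_square_scale: "norm_square (scale c x) = abs_square c * norm_square x"
proof -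
  have "ip (scale c x) (scale c x) = of_real (abs_square c * norm_square x)"
    unfolding of_real_mult mult_conjugate[symmetric] ip_self[of x, symmetric]
    by (simp add: ip_scale_left ip_scale_right mult.assoc)
  then show ?thesis by (simp add: norm_square_def)
qed

lemma norm_square_normalize:
  assumes "u \<noteq> 0"
  shows "norm_square (scale (of_real (1 / sqrt (norm_square u))) u) = 1"
  unfolding norm_square_scale abs_square_of_real using assms by (simp add: power_divide)

lemma ip_eq_0_commute: "ip x y = 0 \<longleftrightarrow> ip y x = 0"
  by (metis ip_conjugate conjugate_zero_iff)

lemma eqI_ip: "(\<And>z. ip x z = ip y z) \<Longrightarrow> x = y"
proof -
  assume "\<And>z. ip x z = ip y z"
  then have "ip (x - y) (x - y) = 0" by (simp add: ip_diff_left)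
  then show "x = y" by simp
qed

section \<open>Orthonormal families and Fourier expansions\<close>

definition orthonormal :: "nat \<Rightarrow> (nat \<Rightarrow> 'v) \<Rightarrow> bool" where
  "orthonormal k e \<longleftrightarrow> (\<forall>i<k. \<forall>j<k. ip (e i) (e j) = (if i = j then 1 else 0))"

lemma orthonormalD: "orthonormal k e \<Longrightarrow> i < k \<Longrightarrow> j < k \<Longrightarrow> ip (e i) (e j) = (if i = j then 1 else 0)"
  by (auto simp: orthonormal_def)

lemma orthonormal_independent:
  assumes "orthonormal k e"
  shows "inj_on e {..<k}" "independent (e ` {..<k})"
proof -
  show inj: "inj_on e {..<k}"
  proof (rule inj_onI)
    fix i j assume "i \<in> {..<k}" "j \<in> {..<k}" "e i = e j"
    then show "i = j"
      using orthonormalD[OF assms, of i j] orthonormalD[OF assms, of i i] by (auto split: if_splits)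
  qed
  show "independent (e ` {..<k})"
  proof (rule independent_if_scalars_zero)
    fix f x assume 0: "(\<Sum>x\<in>e ` {..<k}. scale (f x) x) = 0" and "x \<in> e ` {..<k}"
    then obtain j where j: "j < k" "x = e j" by auto
    have "0 = ip (\<Sum>i<k. scale (f (e i)) (e i)) (e j)"
      using 0 by (simp add: sum.reindex[OF inj])
    also have "\<dots> = (\<Sum>i<k. if i = j then f (e i) else 0)"
      unfolding ip_simps by (rule sum.cong) (use j in \<open>simp_all add: orthonormalD[OF assms]\<close>)
    also have "\<dots> = f x" using j by simp
    finally show "f x = 0" by simp
  qed auto
qed

text \<open>Completeness is encoded as the Fourier expansion rather than by a span, because the
  later computations work with coefficients; \<open>onb_dim\<close> recovers the dimension.\<close>

definition onb :: "'v set \<Rightarrow> nat \<Rightarrow> (nat \<Rightarrow> 'v) \<Rightarrow> bool" where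
  "onb S k e \<longleftrightarrow> (\<forall>i<k. e i \<in> S) \<and> orthonormal k e \<and>
     (\<forall>v\<in>S. v = (\<Sum>i<k. scale (ip v (e i)) (e i)))"

lemma onb_orthonormal: "onb S k e \<Longrightarrow> orthonormal k e"
  by (simp add: onb_def)

lemma onb_expansion: "onb S k e \<Longrightarrow> v \<in> S \<Longrightarrow> (\<Sum>i<k. scale (ip v (e i)) (e i)) = v"
  by (simp add: onb_def)

lemma onb_mem: "onb S k e \<Longrightarrow> i < k \<Longrightarrow> e i \<in> S"
  by (simp add: onb_def)

lemma onb_dim:
  assumes "onb S k e"
  shows "dim S = k"
proof (rule dim_unique)
  show "e ` {..<k} \<subseteq> S" using assms by (auto simp: onb_def)
  show "S \<subseteq> span (e ` {..<k})"
  proof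
    fix v assume "v \<in> S"
    then have "v = (\<Sum>i<k. scale (ip v (e i)) (e i))"
      using assms by (simp add: onb_def)
    also have "\<dots> \<in> span (e ` {..<k})"
      by (intro span_sum span_scale span_base) auto
    finally show "v \<in> span (e ` {..<k})" .
  qed
  show "independent (e ` {..<k})" "card (e ` {..<k}) = k"
    using orthonormal_independent[OF onb_orthonormal[OF assms]] by (auto simp: card_image)
qed

lemma ip_expansion:
  assumes "orthonormal k e" "j < k"
  shows "ip (\<Sum>i<k. scale (c i) (e i)) (e j) = c j"
proof -
  have "ip (\<Sum>i<k. scale (c i) (e i)) (e j) = (\<Sum>i<k. if i = j then c i else 0)"
    unfolding ip_simps by (rule sum.cong) (use assms in \<open>simp_all add: orthonormalD[OF assms(1)]\<close>)
  then show ?thesis using assms(2) by simp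
qed

text \<open>Independent vectors as many as the dimension span \<open>S\<close>, and orthonormality
  identifies the coefficients of any expansion as inner products.\<close>

lemma orthonormal_onb:
  assumes "orthonormal k e" "\<And>i. i < k \<Longrightarrow> e i \<in> S" "dim S = k"
  shows "onb S k e"
  unfolding onb_def
proof (intro conjI ballI allI impI)
  fix v assume v: "v \<in> S"
  have card: "card (e ` {..<k}) = k"
    using orthonormal_independent(1)[OF assms(1)] by (simp add: card_image)
  have "S \<subseteq> span (e ` {..<k})"
    by (rule card_ge_dim_independent)
      (use assms card orthonormal_independent(2)[OF assms(1)] in auto)
  then have "v \<in> span (e ` {..<k})" using v by blast
  then obtain u where "v = (\<Sum>x\<in>e ` {..<k}. scale (u x) x)"
    using span_finite[of "e ` {..<k}"] by auto
  then have u: "v = (\<Sum>i<k. scale (u (e i)) (e i))"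
    by (simp add: sum.reindex[OF orthonormal_independent(1)[OF assms(1)]])
  then have "ip v (e i) = u (e i)" if "i < k" for i
    using ip_expansion[OF assms(1) that] by simp
  then show "v = (\<Sum>i<k. scale (ip v (e i)) (e i))"
    using u by simp
qed (use assms in auto)

lemma parseval:
  assumes "onb S k e" "x \<in> S"
  shows "ip x y = (\<Sum>i<k. ip x (e i) * conjugate (ip y (e i)))"
proof -
  have "ip x y = ip (\<Sum>i<k. scale (ip x (e i)) (e i)) y"
    using onb_expansion[OF assms] by simp
  then show ?thesis
    by (simp add: ip_simps flip: ip_conjugate[of "e _" y])
qed

lemma bessel_eq:
  assumes "onb S k e" "x \<in> S"
  shows "norm_square x = (\<Sum>i<k. abs_square (ip x (e i)))"
  unfolding norm_square_def parseval[OF assms, of x] real_part_sum abs_square_def ..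

lemma abs_square_ip_commute: "abs_square (ip x y) = abs_square (ip y x)"
  by (subst ip_conjugate) (rule abs_square_conjugate)

end

section \<open>Nonincreasing rearrangements\<close>

lemma length_nonincreasing [simp]: "length (nonincreasing x) = length x"
  by (simp add: nonincreasing_def)

lemma nonincreasing_permutation:
  obtains p where "p permutes {..<length x}"
    "\<And>i. i < length x \<Longrightarrow> nonincreasing x ! i = x ! p i"
proof -
  have "mset (nonincreasing x) = mset x"
    by (simp add: nonincreasing_def)
  then obtain p where "p permutes {..<length x}" "permute_list p x = nonincreasing x"
    using mset_eq_permutation[of "nonincreasing x" x] by auto
  then show ?thesis using that[of p] by (metis permute_list_nth)
qed

lemma nonincreasing_nth_mono:
  "i \<le> j \<Longrightarrow> j < length x \<Longrightarrow> nonincreasing x ! j \<le> nonincreasing x ! i"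
  using sorted_nth_mono[of "sort x" "length x - Suc j" "length x - Suc i"]
  by (simp add: nonincreasing_def rev_nth)

section \<open>Spectral theorem\<close>

lemma poly_map_poly_of_real_add:
  "poly (map_poly of_real (p + q)) z = poly (map_poly of_real p) z + poly (map_poly of_real q) (z :: complex)"
  by (induction p q rule: poly_induct2) (simp_all add: map_poly_pCons algebra_simps)

lemma poly_map_poly_of_real_mult:
  "poly (map_poly of_real (p * q)) z = poly (map_poly of_real p) z * poly (map_poly of_real q) (z :: complex)"
proof (induction p)
  case (pCons a p)
  have smult: "map_poly of_real (smult a q) = smult (complex_of_real a) (map_poly of_real q)"
    by (rule map_poly_smult) simp_all
  show ?case
    by (simp add: poly_map_poly_of_real_add map_poly_pCons pCons.IH smult algebra_simps)
qed simp

text \<open>A complex root exists by the fundamental theorem of algebra. If it is real, it splits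
  off a linear factor. Otherwise the remainder modulo the quadratic has degree at most 1, real
  coefficients and a nonreal root, so it is 0.\<close>

lemma real_poly_has_linear_or_quadratic_factor:
  fixes q :: "real poly"
  assumes "degree q > 0"
  obtains r h where "q = [:- r, 1:] * h"
    | a b h where "b \<noteq> 0" "q = [:a\<^sup>2 + b\<^sup>2, - 2 * a, 1:] * h"
proof -
  have "degree (map_poly complex_of_real q) = degree q"
    by (rule map_poly_degree_eq) (use assms in auto)
  then have "\<not> constant (poly (map_poly complex_of_real q))"
    using assms by (simp add: constant_degree)
  then obtain z where z: "poly (map_poly complex_of_real q) z = 0"
    using fundamental_theorem_of_algebra by blast
  show thesis
  proof (cases "Im z = 0")
    case True
    have "poly (map_poly complex_of_real q) (of_real r) = of_real (poly q r)" for r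
      by (induction q) (simp_all add: map_poly_pCons)
    moreover have "z = of_real (Re z)" using True by (simp add: complex_eq_iff)
    ultimately have "poly q (Re z) = 0" using z by (metis of_real_eq_0_iff)
    then show ?thesis using that(1) by (auto simp: poly_eq_0_iff_dvd)
  next
    case False
    \<comment> \<open>This is \<open>(x - z) * (x - cnj z)\<close>.\<close>
    define f where "f = [:(Re z)\<^sup>2 + (Im z)\<^sup>2, - 2 * Re z, 1:]"
    have f: "poly (map_poly complex_of_real f) z = 0"
      by (simp add: f_def map_poly_pCons complex_eq_iff power2_eq_square algebra_simps)
    have "degree f = 2" "f \<noteq> 0" by (simp_all add: f_def)
    then have "q mod f = 0 \<or> degree (q mod f) < 2"
      using degree_mod_less[of f q] by simp
    then have "degree (q mod f) \<le> 1" by auto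
    then obtain c d where cd: "q mod f = [:c, d:]"
    proof -
      have "q mod f = [:coeff (q mod f) 0, coeff (q mod f) 1:]"
        using \<open>degree (q mod f) \<le> 1\<close>
        by (intro poly_eqI) (auto simp: coeff_pCons coeff_eq_0 split: nat.split)
      then show ?thesis using that by blast
    qed
    have "poly (map_poly complex_of_real (f * (q div f) + q mod f)) z = 0"
      using z by simp
    then have "poly (map_poly complex_of_real (q mod f)) z = 0"
      unfolding poly_map_poly_of_real_add poly_map_poly_of_real_mult f by simp
    then have "of_real c + z * of_real d = 0"
      unfolding cd by (simp add: map_poly_pCons)
    then have "d = 0 \<and> c = 0"
      using False by (auto simp: complex_eq_iff)
    then have "q = f * (q div f)"
      using cd mult_div_mod_eq[of f q] by simp
    then show ?thesis using that(2)[OF False] by (simp add: f_def)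
  qed
qed

context fin_dim_inner_product_space
begin

section \<open>Self-adjoint operators and real polynomials in them\<close>

definition self_adjoint :: "('v \<Rightarrow> 'v) \<Rightarrow> bool" where
  "self_adjoint A \<longleftrightarrow> (\<forall>x y. ip (A x) y = ip x (A y))"

lemma self_adjointD: "self_adjoint A \<Longrightarrow> ip (A x) y = ip x (A y)"
  by (simp add: self_adjoint_def)

context
  fixes A :: "'v \<Rightarrow> 'v"
  assumes A: "self_adjoint A"
begin

text \<open>Linearity comes out of the defining identity: once \<open>A\<close> has moved to the
  other argument, linearity of \<open>ip\<close> applies, and \<open>eqI_ip\<close> cancels the test
  vector.\<close>

lemma self_adjoint_add: "A (x + y) = A x + A y"
  by (rule eqI_ip) (simp add: self_adjointD[OF A] ip_simps)

lemma self_adjoint_scale: "A (scale c x) = scale c (A x)"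
  by (rule eqI_ip) (simp add: self_adjointD[OF A] ip_simps)

lemma self_adjoint_0 [simp]: "A 0 = 0"
  by (rule eqI_ip) (simp add: self_adjointD[OF A])

lemma self_adjoint_diff: "A (x - y) = A x - A y"
  by (rule eqI_ip) (simp add: self_adjointD[OF A] ip_simps)

lemma self_adjoint_sum: "A (sum f I) = (\<Sum>i\<in>I. A (f i))"
  by (rule eqI_ip) (simp add: self_adjointD[OF A] ip_simps)

lemma self_adjoint_funpow: "self_adjoint (A ^^ n)"
proof (induction n)
  case (Suc n)
  then show ?case
    using A by (simp add: self_adjoint_def funpow_swap1)
qed (simp add: self_adjoint_def)

text \<open>The vector \<open>q(A) u\<close>. Real coefficients make the calculus the same over both
  scalar fields.\<close>

definition poly_apply :: "real poly \<Rightarrow> 'v \<Rightarrow> 'v" where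
  "poly_apply q u = (\<Sum>i\<le>degree q. scale (of_real (coeff q i)) ((A ^^ i) u))"

lemma poly_apply_cutoff:
  "degree q \<le> N \<Longrightarrow> poly_apply q u = (\<Sum>i\<le>N. scale (of_real (coeff q i)) ((A ^^ i) u))"
  unfolding poly_apply_def
  by (rule sum.mono_neutral_left) (auto simp: coeff_eq_0 not_le)

lemma poly_apply_0 [simp]: "poly_apply 0 u = 0"
  by (simp add: poly_apply_def)

lemma poly_apply_pCons: "poly_apply (pCons a q) u = scale (of_real a) u + A (poly_apply q u)"
proof -
  have "poly_apply (pCons a q) u = (\<Sum>i\<le>Suc (degree q). scale (of_real (coeff (pCons a q) i)) ((A ^^ i) u))"
    by (rule poly_apply_cutoff) (rule degree_pCons_le)
  also have "\<dots> = scale (of_real a) u + (\<Sum>i\<le>degree q. scale (of_real (coeff q i)) (A ((A ^^ i) u)))"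
    by (subst sum.atMost_Suc_shift) simp
  finally show ?thesis
    by (simp add: poly_apply_def self_adjoint_sum self_adjoint_scale)
qed

lemma poly_apply_add: "poly_apply (p + q) u = poly_apply p u + poly_apply q u"
  by (induction p q rule: poly_induct2)
    (simp_all add: poly_apply_pCons self_adjoint_add scale_left_distrib algebra_simps)

lemma poly_apply_smult: "poly_apply (smult a q) u = scale (of_real a) (poly_apply q u)"
  by (induction q)
    (simp_all add: poly_apply_pCons self_adjoint_scale scale_right_distrib)

lemma poly_apply_mult: "poly_apply (p * q) u = poly_apply p (poly_apply q u)"
  by (induction p) (simp_all add: poly_apply_pCons poly_apply_add poly_apply_smult)

lemma poly_apply_mem:
  assumes "subspace S" "\<And>x. x \<in> S \<Longrightarrow> A x \<in> S" "u \<in> S"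
  shows "poly_apply q u \<in> S"
  by (induction q)
    (simp_all add: poly_apply_pCons assms subspace_0 subspace_add subspace_scale)

text \<open>Factors are peeled off by induction on the degree. With cofactor \<open>h\<close>, a
  linear factor makes \<open>poly_apply h v\<close> an eigenvector unless \<open>h\<close> already
  annihilates \<open>v\<close>; a quadratic factor without real root is injective on vectors and can
  be discarded.\<close>

lemma eigenvector_of_annihilating_poly:
  assumes S: "subspace S" "\<And>x. x \<in> S \<Longrightarrow> A x \<in> S"
    and "v \<in> S" "v \<noteq> 0" "q \<noteq> 0" "poly_apply q v = 0"
  shows "\<exists>u\<in>S. u \<noteq> 0 \<and> (\<exists>r. A u = scale (of_real r) u)"
  using assms(5,6)
proof (induction "degree q" arbitrary: q rule: less_induct)
  case (less q)
  have "degree q \<noteq> 0"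
  proof
    assume "degree q = 0"
    then obtain a where "q = [:a:]" using degree0_coeffs by blast
    then show False using less.prems assms(4) by (simp add: poly_apply_pCons)
  qed
  then have "degree q > 0" by simp
  then show ?case
  proof (cases rule: real_poly_has_linear_or_quadratic_factor)
    case (1 r h)
    have h: "h \<noteq> 0" "degree h < degree q"
      using less.prems(1) unfolding 1 by (auto simp: degree_mult_eq simp del: mult_pCons_left)
    show ?thesis
    proof (cases "poly_apply h v = 0")
      case True
      then show ?thesis using less.hyps h by blast
    next
      case False
      have "A (poly_apply h v) = scale (of_real r) (poly_apply h v)"
        using less.prems(2) unfolding 1 poly_apply_mult
        by (simp add: poly_apply_pCons)
      then show ?thesis
        using False poly_apply_mem[OF S assms(3)] by blast
    qed
  next
    case (2 a b h)
    define u where "u = poly_apply h v"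
    have h: "h \<noteq> 0" "degree h < degree q"
      using less.prems(1) unfolding 2 by (auto simp: degree_mult_eq simp del: mult_pCons_left)
    have u: "scale (of_real (a\<^sup>2 + b\<^sup>2)) u - scale (of_real (2 * a)) (A u) + A (A u) = 0"
      using less.prems(2) unfolding 2 poly_apply_mult u_def
      by (simp add: poly_apply_pCons self_adjoint_add self_adjoint_diff self_adjoint_scale algebra_simps)
    define w where "w = A u - scale (of_real a) u"
    \<comment> \<open>The quadratic factor acts as \<open>(A - a)^2 + b^2\<close>, so its quadratic
      form at \<open>u\<close> is a sum of two nonnegative terms; as \<open>b\<close> is nonzero, it
      can vanish only for \<open>u = 0\<close>.\<close>
    have "norm_square w + b\<^sup>2 * norm_square u
        = real_part (ip (scale (of_real (a\<^sup>2 + b\<^sup>2)) u - scale (of_real (2 * a)) (A u) + A (A u)) u)"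
      by (simp add: w_def norm_square_def ip_simps real_part_add real_part_diff
          self_adjointD[OF A] algebra_simps power2_eq_square)
    also have "\<dots> = 0" unfolding u by simp
    finally have "b\<^sup>2 * norm_square u = 0"
      by (smt (verit) norm_square_nonneg mult_nonneg_nonneg zero_le_power2)
    then have "u = 0" using 2 by simp
    then show ?thesis using less.hyps h unfolding u_def by blast
  qed
qed

lemma in_span_image_lessThan:
  assumes "x \<in> span (f ` {..<d::nat})"
  shows "\<exists>c. x = (\<Sum>i<d. scale (c i) (f i))"
  using assms
proof (induction d arbitrary: x)
  case (Suc d)
  then obtain b where "x - scale b (f d) \<in> span (f ` {..<d})"
    unfolding lessThan_Suc image_insert span_insert by blast
  then obtain c where c: "x - scale b (f d) = (\<Sum>i<d. scale (c i) (f i))"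
    using Suc.IH by blast
  then have "x = (\<Sum>i<Suc d. scale ((c(d := b)) i) (f i))"
    by (simp add: algebra_simps)
  then show ?case by blast
qed simp

lemma ip_funpow_real:
  obtains g where "\<And>i j. ip ((A ^^ i) v) ((A ^^ j) v) = of_real (g (i + j))"
proof -
  have "\<exists>r. ip ((A ^^ k) v) v = of_real r" for k
    by (rule conjugate_eq_self_imp_of_real[of "ip ((A ^^ k) v) v"])
      (auto simp: self_adjointD[OF self_adjoint_funpow] simp flip: ip_conjugate)
  then obtain g where g: "ip ((A ^^ k) v) v = of_real (g k)" for k
    by metis
  have "ip ((A ^^ i) v) ((A ^^ j) v) = of_real (g (i + j))" for i j
    unfolding g[symmetric] self_adjointD[OF self_adjoint_funpow, of j "(A ^^ i) v", symmetric]
    by (simp add: add.commute[of i] funpow_add)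
  then show ?thesis using that by blast
qed

text \<open>The Gram matrix of the vectors \<open>v, A v, A\<^sup>2 v, \<dots>\<close> is real, so the real parts of the
  coefficients of a linear dependency between them form a dependency as well.\<close>

lemma ex_annihilating_poly: "\<exists>q. q \<noteq> 0 \<and> poly_apply q v = 0"
proof -
  define f where "f i = (A ^^ i) v" for i
  have "\<exists>d. f d \<in> span (f ` {..<d})"
  proof (rule ccontr)
    assume "\<not> ?thesis"
    then have "dim (f ` {..<d}) = d" for d
      by (induction d) (simp_all add: lessThan_Suc dim_insert)
    then show False
      using dim_subset_UNIV[of "f ` {..<Suc dimension}"] by simp
  qed
  then obtain d where "f d \<in> span (f ` {..<d})" ..
  then obtain c where c: "f d = (\<Sum>i<d. scale (c i) (f i))"
    using in_span_image_lessThan by blast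
  obtain g where g: "\<And>i j. ip (f i) (f j) = of_real (g (i + j))"
    unfolding f_def using ip_funpow_real[of v] by blast
  \<comment> \<open>Because the Gram matrix is real, conjugating the coefficients of the dependency
    leaves \<open>w\<close> orthogonal to every \<open>f j\<close>. But \<open>w\<close> is a
    combination of these vectors, hence orthogonal to itself and 0. Averaging the two dependencies
    makes the coefficients real.\<close>
  define w where "w = f d - (\<Sum>i<d. scale (conjugate (c i)) (f i))"
  have w: "ip w (f j) = 0" for j
  proof -
    have "0 = conjugate (ip (f d - (\<Sum>i<d. scale (c i) (f i))) (f j))"
      using c by simp
    also have "\<dots> = ip w (f j)"
      by (simp add: w_def ip_simps g conjugate_diff sum_conjugate conjugate_dist_mul)
    finally show ?thesis by simp
  qed
  have "ip w w = ip w (f d) - (\<Sum>i<d. ip w (scale (conjugate (c i)) (f i)))"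
    by (subst (2) w_def) (simp only: ip_diff_right ip_sum_right)
  then have "ip w w = 0"
    by (simp add: ip_scale_right w)
  then have c': "f d = (\<Sum>i<d. scale (conjugate (c i)) (f i))"
    by (simp add: w_def)
  define r where "r i = real_part (c i)" for i
  have "f d + f d = (\<Sum>i<d. scale (c i + conjugate (c i)) (f i))"
    using c c' by (simp add: scale_left_distrib sum.distrib)
  also have "\<dots> = scale 2 (\<Sum>i<d. scale (of_real (r i)) (f i))"
    by (simp add: add_conjugate r_def scale_sum_right)
  finally have "scale 2 (f d) = scale 2 (\<Sum>i<d. scale (of_real (r i)) (f i))"
    using scale_left_distrib[of 1 1 "f d"] by simp
  then have fd: "f d = (\<Sum>i<d. scale (of_real (r i)) (f i))"
    by simp
  \<comment> \<open>The leading coefficient 1 keeps \<open>q\<close> nonzero even if all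
    \<open>r i\<close> vanish.\<close>
  define q where "q = monom 1 d - (\<Sum>i<d. monom (r i) i)"
  have coeff: "coeff q j = (if j = d then 1 else 0) - (if j < d then r j else 0)" for j
    by (auto simp: q_def coeff_sum)
  have "degree q \<le> d"
    by (rule degree_le) (auto simp: coeff)
  then have "poly_apply q v = (\<Sum>i\<le>d. scale (of_real (coeff q i)) (f i))"
    by (simp add: poly_apply_cutoff f_def)
  also have "\<dots> = f d - (\<Sum>i<d. scale (of_real (r i)) (f i))"
    by (simp add: coeff lessThan_Suc_atMost[symmetric] sum_negf)
  finally have "poly_apply q v = 0" using fd by simp
  moreover have "coeff q d = 1" by (simp add: coeff)
  then have "q \<noteq> 0" by auto
  ultimately show ?thesis by blast
qed

lemma ex_eigenvector:
  assumes "subspace S" "\<And>x. x \<in> S \<Longrightarrow> A x \<in> S" "S \<noteq> {0}"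
  obtains u r where "u \<in> S" "norm_square u = 1" "A u = scale (of_real r) u"
proof -
  obtain v where v: "v \<in> S" "v \<noteq> 0"
    using assms(3) subspace_0[OF assms(1)] by blast
  obtain q where q: "q \<noteq> 0" "poly_apply q v = 0"
    using ex_annihilating_poly by blast
  obtain u r where u: "u \<in> S" "u \<noteq> 0" "A u = scale (of_real r) u"
    using eigenvector_of_annihilating_poly[OF assms(1,2) v q] by blast
  define c where "c = 1 / sqrt (norm_square u)"
  have "norm_square (scale (of_real c) u) = 1"
    unfolding c_def using u(2) by (rule norm_square_normalize)
  moreover have "A (scale (of_real c) u) = scale (of_real r) (scale (of_real c) u)"
    by (simp add: self_adjoint_scale u(3) mult.commute)
  ultimately show ?thesis
    using that u(1) subspace_scale[OF assms(1)] by blast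
qed

end

section \<open>Orthonormal eigenbases of invariant subspaces\<close>

definition eigenbasis :: "('v \<Rightarrow> 'v) \<Rightarrow> 'v set \<Rightarrow> nat \<Rightarrow> (nat \<Rightarrow> 'v) \<Rightarrow> (nat \<Rightarrow> real) \<Rightarrow> bool" where
  "eigenbasis A S k e l \<longleftrightarrow> onb S k e \<and> (\<forall>i<k. A (e i) = scale (of_real (l i)) (e i))"

lemma onb_insert:
  assumes S: "subspace S" and u: "u \<in> S" "norm_square u = 1"
    and e: "onb {v \<in> S. ip v u = 0} k e"
  shows "onb S (Suc k) (case_nat u e)"
  unfolding onb_def
proof (intro conjI allI impI ballI)
  have uu: "ip u u = 1" using u by (simp add: ip_self)
  have eu: "ip (e i) u = 0" "ip u (e i) = 0" if "i < k" for i
    using onb_mem[OF e that] ip_eq_0_commute by auto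
  show "case_nat u e i \<in> S" if "i < Suc k" for i
    using that u onb_mem[OF e] by (cases i) auto
  show "orthonormal (Suc k) (case_nat u e)"
    unfolding orthonormal_def
    by (auto simp: uu eu orthonormalD[OF onb_orthonormal[OF e]] split: nat.split)
  fix v assume v: "v \<in> S"
  define w where "w = v - scale (ip v u) u"
  have "w \<in> {v \<in> S. ip v u = 0}"
    using v u S by (auto simp: w_def ip_simps uu subspace_diff subspace_scale)
  then have "w = (\<Sum>i<k. scale (ip w (e i)) (e i))"
    by (simp add: onb_expansion[OF e])
  also have "\<dots> = (\<Sum>i<k. scale (ip v (e i)) (e i))"
    by (rule sum.cong) (simp_all add: w_def ip_simps eu)
  finally show "v = (\<Sum>i<Suc k. scale (ip v (case_nat u e i)) (case_nat u e i))"
    unfolding sum.lessThan_Suc_shift by (simp add: w_def algebra_simps)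
qed

lemma subspace_orthogonal: "subspace S \<Longrightarrow> subspace {v \<in> S. ip v u = 0}"
  unfolding subspace_def by (auto simp: ip_simps)

text \<open>A self-adjoint operator preserves the orthogonal complement of an eigenvector, so
  splitting one off lowers the dimension. General invariant subspaces are needed: later applications
  concern \<open>X\<close>, \<open>Y\<close> and the complement of a family of eigenvectors.\<close>

lemma ex_eigenbasis:
  assumes A: "self_adjoint A" and "subspace S" "\<And>x. x \<in> S \<Longrightarrow> A x \<in> S"
  shows "\<exists>e l. eigenbasis A S (dim S) e l"
  using assms(2,3)
proof (induction "dim S" arbitrary: S rule: less_induct)
  case (less S)
  show ?case
  proof (cases "S = {0}")
    case True
    then have "eigenbasis A S (dim S) e l" for e l
      by (simp add: eigenbasis_def onb_def orthonormal_def)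
    then show ?thesis by blast
  next
    case False
    obtain u r where u: "u \<in> S" "norm_square u = 1" "A u = scale (of_real r) u"
      using ex_eigenvector[OF A less.prems False] by blast
    define T where "T = {v \<in> S. ip v u = 0}"
    have T: "subspace T" using less.prems(1) subspace_orthogonal unfolding T_def by blast
    have AT: "A x \<in> T" if "x \<in> T" for x
      using that less.prems(2) u(3) by (auto simp: T_def self_adjointD[OF A] ip_scale_right)
    have "u \<notin> T" using u by (auto simp: T_def ip_self)
    then have "T \<noteq> S" using u(1) by blast
    moreover have "T \<subseteq> S" by (auto simp: T_def)
    ultimately have "dim T < dim S"
      using subspace_dim_equal[OF T less.prems(1)] by (meson not_le)
    then obtain e l where e: "eigenbasis A T (dim T) e l"
      using less.hyps T AT by blast
    have onb: "onb S (Suc (dim T)) (case_nat u e)"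
      using onb_insert[OF less.prems(1) u(1,2)] e unfolding T_def eigenbasis_def by blast
    have "eigenbasis A S (dim S) (case_nat u e) (case_nat r l)"
      unfolding eigenbasis_def using e onb onb_dim[OF onb] u(3)
      by (auto simp: eigenbasis_def split: nat.split)
    then show ?thesis by blast
  qed
qed

lemma ex_antimono_permutation:
  fixes l :: "nat \<Rightarrow> real"
  obtains p where "p permutes {..<k}" "antimono_on {..<k} (\<lambda>i. l (p i))"
proof -
  obtain p where p: "p permutes {..<k}"
    "\<And>i. i < k \<Longrightarrow> nonincreasing (map l [0..<k]) ! i = map l [0..<k] ! p i"
    by (rule nonincreasing_permutation[of "map l [0..<k]"]) auto
  have "l (p j) \<le> l (p i)" if "i \<le> j" "j < k" for i j
    using nonincreasing_nth_mono[of i j "map l [0..<k]"] that p(2)[of i] p(2)[of j]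
      permutes_in_image[OF p(1), of i] permutes_in_image[OF p(1), of j] by simp
  then have "antimono_on {..<k} (\<lambda>i. l (p i))"
    by (auto simp: monotone_on_def)
  then show ?thesis using that p(1) by blast
qed

lemma eigenbasis_permute:
  assumes "eigenbasis A S k e l" "p permutes {..<k}"
  shows "eigenbasis A S k (\<lambda>i. e (p i)) (\<lambda>i. l (p i))"
proof -
  have p: "p i < k" if "i < k" for i
    using that permutes_in_image[OF assms(2), of i] by simp
  have e: "onb S k e" using assms by (simp add: eigenbasis_def)
  have "onb S k (\<lambda>i. e (p i))"
  proof (rule orthonormal_onb)
    show "orthonormal k (\<lambda>i. e (p i))"
      unfolding orthonormal_def
      using p orthonormalD[OF onb_orthonormal[OF e]] injD[OF permutes_inj[OF assms(2)]]
      by auto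
  qed (use e p onb_dim onb_mem in auto)
  then show ?thesis using assms p by (simp add: eigenbasis_def)
qed

theorem spectral_theorem:
  assumes "self_adjoint A" and "subspace S" "\<And>x. x \<in> S \<Longrightarrow> A x \<in> S"
  obtains e l where "eigenbasis A S (dim S) e l" "antimono_on {..<dim S} l"
proof -
  obtain e l where e: "eigenbasis A S (dim S) e l"
    using ex_eigenbasis[OF assms] by blast
  obtain p where "p permutes {..<dim S}" "antimono_on {..<dim S} (\<lambda>i. l (p i))"
    using ex_antimono_permutation by blast
  then show ?thesis using that eigenbasis_permute[OF e] by blast
qed

section \<open>Orthogonal projectors\<close>

definition projector :: "('v \<Rightarrow> 'v) \<Rightarrow> bool" where
  "projector Q \<longleftrightarrow> self_adjoint Q \<and> (\<forall>x. Q (Q x) = Q x)"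

lemma projector_self_adjoint: "projector Q \<Longrightarrow> self_adjoint Q"
  by (simp add: projector_def)

lemma projector_idem: "projector Q \<Longrightarrow> Q (Q x) = Q x"
  by (simp add: projector_def)

lemma projector_complement:
  assumes "projector Q"
  shows "projector (\<lambda>x. x - Q x)"
  using projector_self_adjoint[OF assms] projector_idem[OF assms]
  by (simp add: projector_def self_adjoint_def self_adjoint_diff ip_simps)

lemma projector_pythagoras:
  assumes "projector Q"
  shows "norm_square (Q x) + norm_square (x - Q x) = norm_square x"
proof -
  have "ip (Q x) (Q x) = ip (Q x) x" "ip (Q x) x = ip x (Q x)"
    using self_adjointD[OF projector_self_adjoint[OF assms]] projector_idem[OF assms] by metis+
  then show ?thesis
    by (simp add: norm_square_def ip_simps real_part_diff)
qed

lemma projector_norm_le: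
  assumes "projector Q"
  shows "norm_square (Q x) \<le> norm_square x"
  using projector_pythagoras[OF assms, of x] norm_square_nonneg[of "x - Q x"] by linarith

lemma ex_onb:
  assumes "subspace S"
  obtains e where "onb S (dim S) e"
  using spectral_theorem[of "\<lambda>x. x" S] assms by (auto simp: self_adjoint_def eigenbasis_def)

text \<open>Justifies the definite description in \<open>orth_proj\<close>: the Fourier sum leaves
  an orthogonal residual, and the difference of two candidates lies in \<open>S\<close> and is
  orthogonal to itself.\<close>

lemma orth_proj_eq:
  assumes e: "onb S k e" and S: "subspace S"
  shows "orth_proj S v = (\<Sum>i<k. scale (ip v (e i)) (e i))"
  unfolding orth_proj_def
proof (rule the_equality)
  define w where "w = (\<Sum>i<k. scale (ip v (e i)) (e i))"
  have w: "w \<in> S"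
    unfolding w_def by (intro subspace_sum[OF S] subspace_scale[OF S] onb_mem[OF e]) simp
  have orth: "ip (v - w) x = 0" if "x \<in> S" for x
  proof -
    have "ip (v - w) (e i) = 0" if "i < k" for i
      using ip_expansion[OF onb_orthonormal[OF e] that]
      by (simp add: w_def ip_diff_left)
    then have "ip (v - w) (\<Sum>i<k. scale (ip x (e i)) (e i)) = 0"
      by (simp add: ip_sum_right ip_scale_right)
    then show ?thesis using onb_expansion[OF e that] by simp
  qed
  then show "(\<Sum>i<k. scale (ip v (e i)) (e i)) \<in> S \<and>
      (\<forall>x\<in>S. ip (v - (\<Sum>i<k. scale (ip v (e i)) (e i))) x = 0)"
    using w unfolding w_def by blast
  fix u assume u: "u \<in> S \<and> (\<forall>x\<in>S. ip (v - u) x = 0)"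
  then have "w - u \<in> S" using w subspace_diff[OF S] by blast
  then have "ip (v - u) (w - u) = 0" "ip (v - w) (w - u) = 0"
    using u orth by blast+
  then have "ip (w - u) (w - u) = 0"
    by (simp add: ip_diff_left)
  then show "u = (\<Sum>i<k. scale (ip v (e i)) (e i))"
    by (simp add: w_def)
qed

context
  fixes S assumes S: "subspace S"
begin

lemma orth_proj_mem: "orth_proj S v \<in> S"
proof -
  obtain e where "onb S (dim S) e" using ex_onb[OF S] .
  then show ?thesis
    unfolding orth_proj_eq[OF \<open>onb S (dim S) e\<close> S]
    by (intro subspace_sum[OF S] subspace_scale[OF S] onb_mem) auto
qed

lemma orth_proj_id:
  assumes "v \<in> S"
  shows "orth_proj S v = v"
proof -
  obtain e where e: "onb S (dim S) e" using ex_onb[OF S] .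
  show ?thesis
    using orth_proj_eq[OF e S] onb_expansion[OF e assms] by simp
qed

lemma projector_orth_proj: "projector (orth_proj S)"
proof -
  obtain e where e: "onb S (dim S) e" using ex_onb[OF S] .
  have "self_adjoint (orth_proj S)"
    unfolding self_adjoint_def orth_proj_eq[OF e S]
    by (simp add: ip_simps flip: ip_conjugate[of "e _"]) (simp add: mult.commute)
  then show ?thesis
    by (simp add: projector_def orth_proj_id orth_proj_mem)
qed

end

lemma adjoint_projectors:
  assumes "projector P" "projector Q"
  shows "adjoint (P \<circ> Q) = Q \<circ> P"
  unfolding adjoint_def
proof (rule the_equality)
  show "\<forall>x y. ip ((P \<circ> Q) x) y = ip x ((Q \<circ> P) y)"
    by (simp add: self_adjointD[OF projector_self_adjoint] assms)
  then show "B = Q \<circ> P" if "\<forall>x y. ip ((P \<circ> Q) x) y = ip x (B y)" for B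
  proof (intro ext)
    fix y
    have "ip x (B y) = ip x ((Q \<circ> P) y)" for x
      using that \<open>\<forall>x y. ip ((P \<circ> Q) x) y = ip x ((Q \<circ> P) y)\<close> by simp
    then have "ip (B y) x = ip ((Q \<circ> P) y) x" for x
      by (subst (1 2) ip_conjugate) simp
    then show "B y = (Q \<circ> P) y" by (rule eqI_ip)
  qed
qed

lemma self_adjoint_sandwich:
  assumes "self_adjoint A" "self_adjoint Q"
  shows "self_adjoint (Q \<circ> A \<circ> Q)"
  using assms by (simp add: self_adjoint_def)

text \<open>The \<open>h j\<close> span a proper subspace, and a vector outside it has a nonzero
  residual orthogonal to them. This supplies the test vector for Weyl's inequality and the new
  vectors when an orthonormal family is completed.\<close>

lemma ex_orthogonal:
  assumes "m < dim (UNIV :: 'v set)"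
  obtains v where "norm_square v = 1" "\<And>j. j < m \<Longrightarrow> ip v (h j) = 0"
proof -
  define S where "S = span (h ` {..<m})"
  have "dim S \<le> card (h ` {..<m})" unfolding S_def by (rule dim_le_card) auto
  also have "\<dots> \<le> m" using card_image_le[of "{..<m}" h] by simp
  finally have "S \<noteq> UNIV" using assms by auto
  then obtain u where u: "u \<notin> S" by auto
  have S: "subspace S" by (simp add: S_def)
  define w where "w = u - orth_proj S u"
  have "w \<noteq> 0" using u orth_proj_mem[OF S, of u] by (auto simp: w_def)
  then have "norm_square (scale (of_real (1 / sqrt (norm_square w))) w) = 1"
    by (rule norm_square_normalize)
  moreover have "ip w x = 0" if "x \<in> S" for x
    using self_adjointD[OF projector_self_adjoint[OF projector_orth_proj[OF S]], of u x]
    by (simp add: w_def ip_diff_left orth_proj_id[OF S that])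
  then have "ip w (h j) = 0" if "j < m" for j
    using that by (simp add: S_def span_base)
  ultimately show ?thesis
    using that[of "scale (of_real (1 / sqrt (norm_square w))) w"] by (simp add: ip_scale_left)
qed

lemma orthonormal_le_dim:
  assumes "orthonormal r f"
  shows "r \<le> dim (UNIV :: 'v set)"
proof -
  have "card (f ` {..<r}) \<le> dim (UNIV :: 'v set)"
    by (rule independent_card_le_dim) (use orthonormal_independent[OF assms] in auto)
  then show ?thesis
    using orthonormal_independent(1)[OF assms] by (simp add: card_image)
qed

lemma orthonormal_extend:
  assumes "orthonormal r f"
  shows "\<exists>g. onb UNIV (dim (UNIV :: 'v set)) g \<and> (\<forall>i<r. g i = f i)"
  using assms
proof (induction "dim (UNIV :: 'v set) - r" arbitrary: r f)
  case 0
  then have "r = dim (UNIV :: 'v set)"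
    using orthonormal_le_dim[OF 0(2)] by linarith
  then show ?case
    using orthonormal_onb[OF 0(2), of UNIV] by auto
next
  case (Suc m)
  then have "r < dim (UNIV :: 'v set)" by linarith
  then obtain v where v: "norm_square v = 1" "\<And>j. j < r \<Longrightarrow> ip v (f j) = 0"
    using ex_orthogonal[of r f] by blast
  then have "ip v v = 1" "\<And>j. j < r \<Longrightarrow> ip (f j) v = 0"
    using ip_eq_0_commute by (auto simp: ip_self)
  then have "orthonormal (Suc r) (f(r := v))"
    using v(2) orthonormalD[OF Suc.prems] by (auto simp: orthonormal_def less_Suc_eq)
  moreover have "m = dim (UNIV :: 'v set) - Suc r" using Suc.hyps(2) by linarith
  ultimately obtain g where "onb UNIV (dim (UNIV :: 'v set)) g" "\<forall>i<Suc r. g i = (f(r := v)) i"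
    using Suc.hyps(1) by blast
  then show ?case by (auto simp: less_Suc_eq)
qed

section \<open>Eigenvalue inequalities\<close>

definition quad :: "('v \<Rightarrow> 'v) \<Rightarrow> 'v \<Rightarrow> real" where
  "quad A v = real_part (ip (A v) v)"

lemma eigenbasis_onb: "eigenbasis A S k e l \<Longrightarrow> onb S k e"
  by (simp add: eigenbasis_def)

lemma eigenbasis_eigen: "eigenbasis A S k e l \<Longrightarrow> i < k \<Longrightarrow> A (e i) = scale (of_real (l i)) (e i)"
  by (simp add: eigenbasis_def)

lemma quad_eigenbasis:
  assumes A: "self_adjoint A" and e: "eigenbasis A S k e l" and v: "v \<in> S"
  shows "quad A v = (\<Sum>i<k. l i * abs_square (ip v (e i)))"
proof -
  have "A v = A (\<Sum>i<k. scale (ip v (e i)) (e i))"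
    using onb_expansion[OF eigenbasis_onb[OF e] v] by simp
  also have "\<dots> = (\<Sum>i<k. scale (of_real (l i) * ip v (e i)) (e i))"
    by (simp add: self_adjoint_sum[OF A] self_adjoint_scale[OF A] eigenbasis_eigen[OF e] mult.commute)
  finally have "ip (A v) v = (\<Sum>i<k. of_real (l i) * (ip v (e i) * conjugate (ip v (e i))))"
    by (simp add: ip_simps mult.assoc flip: ip_conjugate[of "e _"])
  then show ?thesis
    by (simp add: quad_def real_part_sum abs_square_def)
qed

text \<open>The min-max principle reduces here to one test vector: a unit vector orthogonal to all
  \<open>f j\<close> with \<open>j < i\<close> and all \<open>e j\<close> with \<open>j > i\<close>
  has \<open>quad A v\<close> at least \<open>a i\<close> and \<open>quad B v\<close> at most
  \<open>b i\<close>. It exists because these are only \<open>n - 1\<close> conditions.\<close>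

lemma weyl_monotonicity:
  assumes A: "self_adjoint A" "eigenbasis A UNIV n e a" "antimono_on {..<n} a"
    and B: "self_adjoint B" "eigenbasis B UNIV n f b" "antimono_on {..<n} b"
    and le: "\<And>v. quad A v \<le> quad B v + t * norm_square v"
    and i: "i < n"
  shows "a i \<le> b i + t"
proof -
  note e = eigenbasis_onb[OF A(2)] and f = eigenbasis_onb[OF B(2)]
  \<comment> \<open>The shift by \<open>Suc\<close> skips \<open>e i\<close>: for
    \<open>j < n - 1\<close> the list runs through \<open>f 0\<close> to \<open>f (i - 1)\<close>
    and then \<open>e (i + 1)\<close> to \<open>e (n - 1)\<close>.\<close>
  define h where "h j = (if j < i then f j else e (Suc j))" for j
  have "n - 1 < dim (UNIV :: 'v set)"
    using i onb_dim[OF e] by linarith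
  then obtain v where v: "norm_square v = 1" "\<And>j. j < n - 1 \<Longrightarrow> ip v (h j) = 0"
    using ex_orthogonal[of "n - 1" h] by blast
  have f0: "ip v (f j) = 0" if "j < i" for j
    using v(2)[of j] that i by (simp add: h_def)
  have e0: "ip v (e j) = 0" if "i < j" "j < n" for j
  proof -
    have "j - 1 < n - 1" "\<not> j - 1 < i" "Suc (j - 1) = j" using that by auto
    then show ?thesis using v(2)[of "j - 1"] by (simp add: h_def)
  qed
  have ge: "a i \<le> a j" if "j \<le> i" for j
    using monotone_onD[OF A(3), of j i] that i by simp
  have le': "b j \<le> b i" if "i \<le> j" "j < n" for j
    using monotone_onD[OF B(3), of i j] that by simp
  have "a i = a i * (\<Sum>j<n. abs_square (ip v (e j)))"
    using v(1) bessel_eq[OF e, of v] by simp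
  also have "\<dots> \<le> (\<Sum>j<n. a j * abs_square (ip v (e j)))"
    unfolding sum_distrib_left
  proof (rule sum_mono)
    fix j assume "j \<in> {..<n}"
    then show "a i * abs_square (ip v (e j)) \<le> a j * abs_square (ip v (e j))"
      using ge[of j] e0[of j] by (cases "j \<le> i") (auto intro: mult_right_mono)
  qed
  also have "\<dots> = quad A v"
    by (simp add: quad_eigenbasis[OF A(1,2)])
  also have "\<dots> \<le> quad B v + t"
    using le[of v] v(1) by simp
  also have "quad B v = (\<Sum>j<n. b j * abs_square (ip v (f j)))"
    by (simp add: quad_eigenbasis[OF B(1,2)])
  also have "\<dots> \<le> (\<Sum>j<n. b i * abs_square (ip v (f j)))"
  proof (rule sum_mono)
    fix j assume "j \<in> {..<n}"
    then show "b j * abs_square (ip v (f j)) \<le> b i * abs_square (ip v (f j))"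
      using le'[of j] f0[of j] by (cases "i \<le> j") (auto intro: mult_right_mono)
  qed
  also have "\<dots> = b i"
    using v(1) bessel_eq[OF f, of v] by (simp flip: sum_distrib_left)
  finally show ?thesis by simp
qed

text \<open>Basis independence of the trace: after exchanging the sums, the weights of each
  eigenvalue add up to the squared length of \<open>e i\<close>, which is 1. The trace itself occurs
  only in the form of such a sum.\<close>

lemma sum_quad_onb:
  assumes A: "self_adjoint A" "eigenbasis A UNIV n e a" and f: "onb UNIV n f"
  shows "(\<Sum>j<n. quad A (f j)) = (\<Sum>i<n. a i)"
proof -
  have "(\<Sum>j<n. quad A (f j)) = (\<Sum>j<n. \<Sum>i<n. a i * abs_square (ip (f j) (e i)))"
    by (simp add: quad_eigenbasis[OF A])
  also have "\<dots> = (\<Sum>i<n. a i * (\<Sum>j<n. abs_square (ip (e i) (f j))))"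
    unfolding sum_distrib_left by (subst sum.swap) (simp add: abs_square_ip_commute)
  also have "\<dots> = (\<Sum>i<n. a i)"
  proof (rule sum.cong)
    fix i assume "i \<in> {..<n}"
    then have "ip (e i) (e i) = 1"
      using orthonormalD[OF onb_orthonormal[OF eigenbasis_onb[OF A(2)]], of i i] by simp
    then have "norm_square (e i) = 1"
      by (simp add: norm_square_def)
    then show "a i * (\<Sum>j<n. abs_square (ip (e i) (f j))) = a i"
      using bessel_eq[OF f, of "e i"] by simp
  qed simp
  finally show ?thesis .
qed

text \<open>Lidskii's inequality in the form needed for weak majorization: raising \<open>B\<close> to \<open>B + C\<close>
  moves every eigenvalue up, so any partial sum of the moves is at most the trace of \<open>C\<close>.\<close>

lemma lidskii:
  assumes A: "self_adjoint A" "eigenbasis A UNIV n e a" "antimono_on {..<n} a"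
    and B: "self_adjoint B" "eigenbasis B UNIV n f b" "antimono_on {..<n} b"
    and C: "self_adjoint C" "\<And>v. quad C v \<ge> 0"
      "\<And>g. onb UNIV n g \<Longrightarrow> (\<Sum>j<n. quad C (g j)) = \<tau>"
    and le: "\<And>v. quad A v \<le> quad B v + quad C v + t * norm_square v"
    and I: "I \<subseteq> {..<n}"
  shows "(\<Sum>i\<in>I. a i - b i) \<le> real (card I) * t + \<tau>"
proof -
  define E where "E v = B v + C v" for v
  have E: "self_adjoint E"
    using B(1) C(1) by (simp add: self_adjoint_def E_def ip_simps)
  have quad: "quad E v = quad B v + quad C v" for v
    by (simp add: quad_def E_def ip_simps real_part_add)
  have n: "dim (UNIV :: 'v set) = n" by (rule onb_dim[OF eigenbasis_onb[OF A(2)]])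
  obtain g c where g: "eigenbasis E UNIV n g c" "antimono_on {..<n} c"
    using spectral_theorem[OF E subspace_UNIV] unfolding n by auto
  \<comment> \<open>The shift \<open>t\<close> is split off while the sum still runs over
    \<open>I\<close>. Only the nonnegative increments \<open>c i - b i\<close> are then extended to
    all indices, so \<open>t\<close> is counted \<open>card I\<close> times and not \<open>n\<close>
    times.\<close>
  have "a i \<le> c i + t" if "i < n" for i
    by (rule weyl_monotonicity[OF A E g _ that]) (use le in \<open>simp add: quad\<close>)
  then have "(\<Sum>i\<in>I. a i - b i) \<le> (\<Sum>i\<in>I. t + (c i - b i))"
    using I by (intro sum_mono) (force simp: algebra_simps)
  also have "\<dots> = real (card I) * t + (\<Sum>i\<in>I. c i - b i)"
    by (simp add: sum.distrib)
  also have "b i \<le> c i + 0" if "i < n" for i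
    by (rule weyl_monotonicity[OF B E g _ that]) (simp add: quad C(2))
  then have "(\<Sum>i\<in>I. c i - b i) \<le> (\<Sum>i<n. c i - b i)"
    using I by (intro sum_mono2) auto
  also have "\<dots> = (\<Sum>j<n. quad E (g j)) - (\<Sum>j<n. quad B (g j))"
    using sum_quad_onb[OF E g(1) eigenbasis_onb[OF g(1)]]
      sum_quad_onb[OF B(1,2) eigenbasis_onb[OF g(1)]]
    by (simp add: sum_subtractf)
  also have "\<dots> = \<tau>"
    using C(3)[OF eigenbasis_onb[OF g(1)]] by (simp add: quad sum.distrib)
  finally show ?thesis by simp
qed

section \<open>Differences of projectors\<close>

lemma quad_projector:
  assumes "projector Q"
  shows "quad Q v = norm_square (Q v)"
proof -
  have "ip (Q v) v = ip (Q v) (Q v)"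
    using self_adjointD[OF projector_self_adjoint[OF assms], of "Q v" v]
    by (simp add: projector_idem[OF assms])
  then show ?thesis by (simp add: quad_def norm_square_def)
qed

section \<open>Compressions of one projector by another\<close>

context
  fixes X :: "'v set" and Q :: "'v \<Rightarrow> 'v" and d x \<mu>
  assumes X: "subspace X" and Q: "projector Q"
    and x: "eigenbasis (orth_proj X \<circ> Q \<circ> orth_proj X) X d x \<mu>"
begin

lemma compression_eigen: "i < d \<Longrightarrow> orth_proj X (Q (x i)) = scale (of_real (\<mu> i)) (x i)"
  using eigenbasis_eigen[OF x, of i] orth_proj_id[OF X onb_mem[OF eigenbasis_onb[OF x]], of i]
  by simp

text \<open>As the projector onto \<open>X\<close> fixes \<open>x j\<close>, it can be inserted next
  to \<open>Q (x i)\<close>, which turns the inner product into the eigenvalue equation. Thus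
  \<open>Q\<close> keeps the eigenvectors orthogonal, and \<open>\<mu> i\<close> is the squared
  length of \<open>Q (x i)\<close>.\<close>

lemma ip_projected_eigenbasis:
  assumes "i < d" "j < d"
  shows "ip (Q (x i)) (Q (x j)) = (if i = j then of_real (\<mu> i) else 0)"
proof -
  have "ip (Q (x i)) (Q (x j)) = ip (Q (x i)) (x j)"
    using self_adjointD[OF projector_self_adjoint[OF Q], of "Q (x i)" "x j"]
    by (simp add: projector_idem[OF Q])
  also have "\<dots> = ip (Q (x i)) (orth_proj X (x j))"
    by (simp add: orth_proj_id[OF X onb_mem[OF eigenbasis_onb[OF x]]] assms)
  also have "\<dots> = ip (orth_proj X (Q (x i))) (x j)"
    by (simp add: self_adjointD[OF projector_self_adjoint[OF projector_orth_proj[OF X]]])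
  finally show ?thesis
    using orthonormalD[OF onb_orthonormal[OF eigenbasis_onb[OF x]] assms]
    by (simp add: compression_eigen assms ip_scale_left)
qed

lemma norm_square_projected_eigenbasis: "i < d \<Longrightarrow> norm_square (Q (x i)) = \<mu> i"
  by (simp add: norm_square_def ip_projected_eigenbasis)

lemma compression_eigenvalue_bounds:
  assumes "i < d"
  shows "0 \<le> \<mu> i" "\<mu> i \<le> 1"
proof -
  have "ip (x i) (x i) = of_real 1"
    using orthonormalD[OF onb_orthonormal[OF eigenbasis_onb[OF x]] assms assms] by simp
  then have "norm_square (x i) = 1"
    by (simp only: norm_square_def real_part_of_real)
  then show "0 \<le> \<mu> i" "\<mu> i \<le> 1"
    using projector_norm_le[OF Q, of "x i"] norm_square_nonneg[of "Q (x i)"]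
    by (simp_all add: norm_square_projected_eigenbasis assms)
qed

text \<open>On \<open>X\<close> the new compression is the identity minus the old one, so squared
  cosines become squared sines along the same vectors.\<close>

lemma compression_complement:
  "eigenbasis (orth_proj X \<circ> (\<lambda>v. v - Q v) \<circ> orth_proj X) X d x (\<lambda>i. 1 - \<mu> i)"
  unfolding eigenbasis_def
proof (intro conjI allI impI eigenbasis_onb[OF x])
  fix i assume i: "i < d"
  then show "(orth_proj X \<circ> (\<lambda>v. v - Q v) \<circ> orth_proj X) (x i) = scale (of_real (1 - \<mu> i)) (x i)"
    by (simp add: orth_proj_id[OF X onb_mem[OF eigenbasis_onb[OF x]]] compression_eigen
        self_adjoint_diff[OF projector_self_adjoint[OF projector_orth_proj[OF X]]] scale_left_diff_distrib)
qed

text \<open>\<open>P Q P\<close> and \<open>Q P Q\<close> have the same nonzero eigenvalues: \<open>Q\<close> maps the eigenvectors of the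
  former to orthogonal eigenvectors of the latter, which vanishes on their complement.\<close>

lemma compression_swap:
  assumes anti: "antimono_on {..<d} \<mu>"
  shows "\<exists>f. eigenbasis (Q \<circ> orth_proj X \<circ> Q) UNIV (dim (UNIV :: 'v set)) f (\<lambda>i. if i < d then \<mu> i else 0)"
proof -
  \<comment> \<open>The number of positive eigenvalues, which come first. From \<open>r\<close> on
    \<open>Q (x i)\<close> is 0 and cannot be normalized, so there the basis is completed
    arbitrarily.\<close>
  define r where "r = (LEAST r. r = d \<or> \<mu> r = 0)"
  have "r = d \<or> \<mu> r = 0" unfolding r_def by (rule LeastI[of _ d]) simp
  moreover have r_le: "r \<le> d" unfolding r_def by (rule Least_le) simp
  ultimately have zero: "\<mu> i = 0" if "r \<le> i" "i < d" for i
    using that monotone_onD[OF anti, of r i] compression_eigenvalue_bounds[of i] by auto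
  have pos: "\<mu> i > 0" if "i < r" for i
    using that not_less_Least[of i "\<lambda>r. r = d \<or> \<mu> r = 0"] compression_eigenvalue_bounds[of i] r_le
    unfolding r_def[symmetric] by (simp add: less_le)
  define f where "f i = scale (of_real (1 / sqrt (\<mu> i))) (Q (x i))" for i
  have "ip (f i) (f j) = (if i = j then 1 else 0)" if "i < r" "j < r" for i j
  proof -
    have "ip (f i) (f j) = of_real (1 / sqrt (\<mu> i) * (1 / sqrt (\<mu> j))) * ip (Q (x i)) (Q (x j))"
      unfolding f_def ip_scale_left ip_scale_right by (simp only: conjugate_of_real of_real_mult ac_simps)
    also have "\<dots> = of_real (if i = j then 1 else 0)"
      using that r_le pos[of j] by (auto simp: ip_projected_eigenbasis simp flip: of_real_mult)
    finally show ?thesis by simp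
  qed
  then have "orthonormal r f" by (simp add: orthonormal_def)
  then obtain g where g: "onb UNIV (dim (UNIV :: 'v set)) g" "\<And>i. i < r \<Longrightarrow> g i = f i"
    using orthonormal_extend by blast
  note sa = projector_self_adjoint[OF projector_orth_proj[OF X]]
  have "(Q \<circ> orth_proj X \<circ> Q) (g i) = scale (of_real (if i < d then \<mu> i else 0)) (g i)"
    if i: "i < dim (UNIV :: 'v set)" for i
  proof (cases "i < r")
    case True
    then have "orth_proj X (Q (g i)) = scale (of_real (1 / sqrt (\<mu> i)) * of_real (\<mu> i)) (x i)"
      using r_le unfolding g(2)[OF True] f_def
      by (simp add: self_adjoint_scale[OF projector_self_adjoint[OF Q]] self_adjoint_scale[OF sa]
          projector_idem[OF Q] compression_eigen)
    then show ?thesis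
      using True r_le by (simp add: g(2) f_def self_adjoint_scale[OF projector_self_adjoint[OF Q]])
  next
    case False
    have "ip (Q (g i)) (x j) = 0" if j: "j < d" for j
    proof (cases "j < r")
      case True
      then have "ip (g i) (f j) = 0"
        using orthonormalD[OF onb_orthonormal[OF g(1)] i, of j] orthonormal_le_dim[OF \<open>orthonormal r f\<close>] False g(2)[OF True]
        by auto
      then have "ip (g i) (Q (x j)) = 0"
        using pos[OF True] by (simp add: f_def ip_scale_right)
      then show ?thesis by (simp add: self_adjointD[OF projector_self_adjoint[OF Q]])
    next
      case False
      then have "norm_square (Q (x j)) = 0"
        using norm_square_projected_eigenbasis[OF j] zero[of j] j by simp
      then show ?thesis by (simp add: self_adjointD[OF projector_self_adjoint[OF Q]])
    qed
    then have "orth_proj X (Q (g i)) = 0"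
      by (simp add: orth_proj_eq[OF eigenbasis_onb[OF x] X])
    then show ?thesis
      using False zero[of i] by (simp add: self_adjoint_0[OF projector_self_adjoint[OF Q]])
  qed
  then show ?thesis using g(1) unfolding eigenbasis_def by blast
qed

end

text \<open>An index with \<open>s i = 0\<close> contributes no eigenvector to the difference of
  projectors studied below; keeping it with \<open>p i = 0\<close> avoids reindexing. Bessel's
  inequality survives such zero vectors: the residual \<open>v - z v\<close> is orthogonal to the
  family, and its squared length is the gap.\<close>

lemma bessel_partial:
  fixes p :: "nat \<Rightarrow> 'v"
  assumes p: "\<And>i j. i < d \<Longrightarrow> j < d \<Longrightarrow> ip (p i) (p j) = (if i = j \<and> s i \<noteq> 0 then 1 else 0)"
    and s: "\<And>i. i < d \<Longrightarrow> s i = 0 \<Longrightarrow> p i = 0"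
  defines "z \<equiv> \<lambda>v. \<Sum>i<d. scale (ip v (p i)) (p i)"
  shows "j < d \<Longrightarrow> ip (v - z v) (p j) = 0"
    and "(\<Sum>i<d. abs_square (ip v (p i))) \<le> norm_square v"
proof -
  show orth: "ip (v - z v) (p j) = 0" if j: "j < d" for j
  proof -
    have "ip (z v) (p j) = (\<Sum>i<d. if i = j then ip v (p j) else 0)"
      unfolding z_def ip_sum_left
      by (rule sum.cong) (use j s in \<open>auto simp: ip_scale_left p\<close>)
    then show ?thesis using j by (simp add: ip_diff_left)
  qed
  have "ip (v - z v) (z v) = 0"
    by (subst (2) z_def) (simp add: ip_sum_right ip_scale_right orth)
  then have "ip (v - z v) (v - z v) = ip v v - ip (z v) v"
    by (simp add: ip_diff_right ip_diff_left)
  also have "ip (z v) v = (\<Sum>i<d. ip v (p i) * conjugate (ip v (p i)))"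
    by (simp add: z_def ip_simps flip: ip_conjugate[of "p _"])
  finally have "norm_square (v - z v) = norm_square v - (\<Sum>i<d. abs_square (ip v (p i)))"
    by (simp add: norm_square_def real_part_diff real_part_sum abs_square_def)
  then show "(\<Sum>i<d. abs_square (ip v (p i))) \<le> norm_square v"
    using norm_square_nonneg[of "v - z v"] by linarith
qed

text \<open>The eigenvectors \<open>x\<^sub>i\<close> of \<open>P R P\<close> on \<open>X\<close> satisfy \<open>D\<^sup>2 x\<^sub>i = s\<^sub>i\<^sup>2 x\<^sub>i\<close> for the difference
  \<open>D = P - R\<close> of the projectors, so \<open>(D + s\<^sub>i) x\<^sub>i\<close> is an eigenvector of \<open>D\<close> for \<open>s\<^sub>i\<close>.  On the
  complement of these eigenvectors \<open>D\<close> has no positive eigenvalue.\<close>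

lemma projector_difference_le:
  assumes X: "subspace X" and Y: "subspace Y"
    and x: "eigenbasis (orth_proj X \<circ> orth_proj Y \<circ> orth_proj X) X d x c"
  defines "s \<equiv> \<lambda>i. sqrt (1 - c i)"
    and "D \<equiv> \<lambda>v. orth_proj X v - orth_proj Y v"
  obtains p where
    "\<And>i j. i < d \<Longrightarrow> j < d \<Longrightarrow> ip (p i) (p j) = (if i = j \<and> s i \<noteq> 0 then 1 else 0)"
    "\<And>i. i < d \<Longrightarrow> s i = 0 \<Longrightarrow> p i = 0"
    "\<And>v. quad D v \<le> (\<Sum>i<d. s i * abs_square (ip v (p i)))"
proof -
  define P R where "P = orth_proj X" and "R = orth_proj Y"
  have PR: "projector P" "projector R"
    using projector_orth_proj X Y by (auto simp: P_def R_def)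
  note sa = PR[THEN projector_self_adjoint] and idem = PR[THEN projector_idem]
  have D: "self_adjoint D"
    using sa by (simp add: self_adjoint_def D_def P_def R_def ip_simps)
  have Px: "P (x i) = x i" "P (R (x i)) = scale (of_real (c i)) (x i)" if "i < d" for i
    using that orth_proj_id[OF X onb_mem[OF eigenbasis_onb[OF x]]]
      compression_eigen[OF X PR(2)[unfolded R_def] x]
    by (simp_all add: P_def R_def)
  have Dv: "D v = P v - R v" for v by (simp add: D_def P_def R_def)
  have s0: "s i \<ge> 0" and s2: "(s i)\<^sup>2 = 1 - c i" if "i < d" for i
    using compression_eigenvalue_bounds[OF X PR(2)[unfolded R_def] x that] by (simp_all add: s_def)
  have PDx: "P (D (x i)) = scale (of_real ((s i)\<^sup>2)) (x i)" if "i < d" for i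
    using that by (simp add: Dv Px self_adjoint_diff[OF sa(1)] s2 scale_left_diff_distrib)
  \<comment> \<open>Since \<open>D (x i) = x i - R (x i)\<close> is annihilated by \<open>R\<close>,
    the second \<open>D\<close> acts on it as \<open>P\<close>.\<close>
  have DDx: "D (D (x i)) = scale (of_real ((s i)\<^sup>2)) (x i)" if "i < d" for i
    using that by (simp add: Dv Px self_adjoint_diff[OF sa(1)] self_adjoint_diff[OF sa(2)] idem s2
        scale_left_diff_distrib)
  note xx = orthonormalD[OF onb_orthonormal[OF eigenbasis_onb[OF x]]]
  have ip1: "ip (D (x i)) (x j) = (if i = j then of_real ((s i)\<^sup>2) else 0)" if "i < d" "j < d" for i j
  proof -
    have "ip (D (x i)) (x j) = ip (P (D (x i))) (x j)"
      using self_adjointD[OF sa(1), of "D (x i)" "x j"] Px(1)[OF that(2)] by simp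
    then show ?thesis using that by (simp add: PDx ip_scale_left xx)
  qed
  have ip2: "ip (D (x i)) (D (x j)) = (if i = j then of_real ((s i)\<^sup>2) else 0)" if "i < d" "j < d" for i j
    using that by (simp add: self_adjointD[OF D, of "D (x i)" "x j", symmetric] DDx ip_scale_left xx)
  define y where "y i = D (x i) + scale (of_real (s i)) (x i)" for i
  \<comment> \<open>The squared length of \<open>y i\<close>: \<open>D (x i)\<close> and the scaled
    \<open>x i\<close> contribute \<open>(s i)^2\<close> each, the two cross terms
    \<open>(s i)^3\<close> each.\<close>
  define N where "N i = 2 * (s i)\<^sup>2 * (1 + s i)" for i
  have Dy: "D (y i) = scale (of_real (s i)) (y i)" if "i < d" for i
    using that by (simp add: y_def self_adjoint_add[OF D] self_adjoint_scale[OF D] DDx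
        scale_right_distrib power2_eq_square add.commute)
  have ip_xDx: "ip (x i) (D (x j)) = ip (D (x i)) (x j)" for i j
    by (simp add: self_adjointD[OF D])
  have ip_y: "ip (y i) (y j) = (if i = j then of_real (N i) else 0)" if "i < d" "j < d" for i j
    using that by (simp add: y_def ip_simps ip_xDx ip1 ip2 xx N_def algebra_simps power2_eq_square)
  \<comment> \<open>For \<open>s i = 0\<close> also \<open>N i = 0\<close>, and division by zero
    makes \<open>p i\<close> the zero vector.\<close>
  define p where "p i = scale (of_real (1 / sqrt (N i))) (y i)" for i
  have N_pos: "N i > 0" if "i < d" "s i \<noteq> 0" for i
  proof -
    have "s i > 0" using s0[OF that(1)] that(2) by simp
    then show ?thesis by (simp add: N_def)
  qed
  have p_s0: "p i = 0" if "i < d" "s i = 0" for i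
    using that by (simp add: p_def N_def)
  have ip_p: "ip (p i) (p j) = (if i = j \<and> s i \<noteq> 0 then 1 else 0)" if "i < d" "j < d" for i j
  proof -
    have "ip (p i) (p j) = of_real (1 / sqrt (N i) * (1 / sqrt (N j))) * ip (y i) (y j)"
      unfolding p_def ip_scale_left ip_scale_right by (simp only: conjugate_of_real of_real_mult ac_simps)
    also have "\<dots> = of_real (if i = j \<and> s i \<noteq> 0 then 1 else 0)"
      using that N_pos[of i] by (auto simp: ip_y N_def simp flip: of_real_mult)
    finally show ?thesis by auto
  qed
  have Dp: "D (p i) = scale (of_real (s i)) (p i)" if "i < d" for i
    using that by (simp add: p_def self_adjoint_scale[OF D] Dy mult.commute)
  define U where "U = {w. \<forall>i<d. ip w (p i) = 0}"
  have U: "subspace U" by (auto simp: U_def subspace_def ip_simps)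
  have DU: "D w \<in> U" if "w \<in> U" for w
    using that by (simp add: U_def self_adjointD[OF D] Dp ip_scale_right)
  obtain e l where e: "eigenbasis D U (dim U) e l"
    using spectral_theorem[OF D U DU] .
  \<comment> \<open>For a positive eigenvalue \<open>l k\<close>, orthogonality of \<open>u\<close>
    to \<open>y i\<close> reads \<open>(l k + s i) * ip u (x i) = 0\<close>. So \<open>u\<close> is
    orthogonal to \<open>X\<close>, and there the form of \<open>D\<close> is minus that of
    \<open>R\<close>, which cannot be positive.\<close>
  have l_le: "l k \<le> 0" if k: "k < dim U" for k
  proof (rule ccontr)
    assume pos: "\<not> l k \<le> 0"
    define u where "u = e k"
    have Du: "D u = scale (of_real (l k)) u" using eigenbasis_eigen[OF e k] by (simp add: u_def)
    have "u \<in> U" using onb_mem[OF eigenbasis_onb[OF e] k] by (simp add: u_def)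
    have "ip u (x i) = 0" if i: "i < d" for i
    proof -
      have "ip u (y i) = 0"
      proof (cases "s i = 0")
        case True
        then have "ip (y i) (y i) = 0" using ip_y[OF i i] by (simp add: N_def)
        then show ?thesis by simp
      next
        case False
        then have "N i \<noteq> 0" using N_pos[OF i] by force
        then show ?thesis using \<open>u \<in> U\<close> i by (auto simp: U_def p_def ip_scale_right)
      qed
      then have "of_real (l k + s i) * ip u (x i) = 0"
        by (simp add: y_def ip_simps self_adjointD[OF D, symmetric] Du algebra_simps)
      moreover have "l k + s i \<noteq> 0" using pos s0[OF i] by linarith
      ultimately show ?thesis by (simp del: of_real_add)
    qed
    then have "P u = 0" by (simp add: P_def orth_proj_eq[OF eigenbasis_onb[OF x] X])
    then have "quad D u = - norm_square (R u)"
      using quad_projector[OF PR(2), of u] by (simp add: quad_def Dv ip_minus_left)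
    moreover have "quad D u = l k"
      using orthonormalD[OF onb_orthonormal[OF eigenbasis_onb[OF e]] k k]
      by (simp add: quad_def Du ip_scale_left) (simp add: u_def)
    ultimately show False using pos norm_square_nonneg[of "R u"] by linarith
  qed
  have "quad D v \<le> (\<Sum>i<d. s i * abs_square (ip v (p i)))" for v
  proof -
    \<comment> \<open>\<open>D\<close> preserves both the span of the \<open>p i\<close>, which
      contains \<open>z\<close>, and \<open>U\<close>, which contains \<open>w\<close>, so no cross
      terms arise; the form is diagonal on the former and nonpositive on the latter.\<close>
    define z where "z = (\<Sum>i<d. scale (ip v (p i)) (p i))"
    define w where "w = v - z"
    have w: "ip w (p j) = 0" if "j < d" for j
      unfolding w_def z_def using bessel_partial(1)[of d p s, OF ip_p p_s0 that] by blast
    then have "w \<in> U" by (simp add: U_def)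
    then have "quad D w = (\<Sum>k<dim U. l k * abs_square (ip w (e k)))"
      by (rule quad_eigenbasis[OF D e])
    also have "\<dots> \<le> 0"
      by (rule sum_nonpos) (simp add: l_le mult_nonpos_nonneg)
    finally have quad_w: "quad D w \<le> 0" .
    have Dz: "D z = (\<Sum>i<d. scale (of_real (s i) * ip v (p i)) (p i))"
      by (simp add: z_def self_adjoint_sum[OF D] self_adjoint_scale[OF D] Dp mult.commute)
    have "ip (D w) z = ip w (D z)" by (simp add: self_adjointD[OF D])
    also have "\<dots> = 0" by (simp add: Dz ip_simps w)
    finally have "ip (D v) v = ip (D w) w + ip (D z) v"
      using self_adjoint_add[OF D, of w z] by (simp add: w_def ip_simps)
    also have "ip (D z) v = (\<Sum>i<d. of_real (s i) * (ip v (p i) * conjugate (ip v (p i))))"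
      by (simp add: Dz ip_simps mult.assoc flip: ip_conjugate[of "p _"])
    finally have "quad D v = quad D w + (\<Sum>i<d. s i * abs_square (ip v (p i)))"
      by (simp add: quad_def real_part_add real_part_sum abs_square_def)
    then show ?thesis using quad_w by linarith
  qed
  then show thesis using that ip_p p_s0 by blast
qed

lemma eigenvalue_extension_antimono:
  assumes X: "subspace X" and Q: "projector Q"
    and x: "eigenbasis (orth_proj X \<circ> Q \<circ> orth_proj X) X d x a" and a: "antimono_on {..<d} a"
  shows "antimono_on {..<n} (\<lambda>i. if i < d then a i else 0)"
  using compression_eigenvalue_bounds[OF X Q x] monotone_onD[OF a] by (auto simp: monotone_on_def)

text \<open>By Bessel's inequality \<open>D\<close> is at most \<open>G + t\<close>. Compressing by
  \<open>Q\<close> gives the hypothesis of \<open>lidskii\<close> with \<open>C\<close> equal to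
  \<open>Q G Q\<close>. Its trace is left as a sum weighted by \<open>norm_square (Q (p i))\<close>,
  so that the bounds for \<open>Q\<close> and for its complement can later be added without
  doubling.\<close>

lemma sum_eigenvalue_diff_le:
  assumes X: "subspace X" and Y: "subspace Y" and Q: "projector Q"
    and x: "eigenbasis (orth_proj X \<circ> Q \<circ> orth_proj X) X d x a" "antimono_on {..<d} a"
    and y: "eigenbasis (orth_proj Y \<circ> Q \<circ> orth_proj Y) Y d y b" "antimono_on {..<d} b"
    and p: "\<And>i j. i < d \<Longrightarrow> j < d \<Longrightarrow> ip (p i) (p j) = (if i = j \<and> s i \<noteq> 0 then 1 else 0)"
      "\<And>i. i < d \<Longrightarrow> s i = 0 \<Longrightarrow> p i = 0"
      "\<And>v. quad (\<lambda>v. orth_proj X v - orth_proj Y v) v \<le> (\<Sum>i<d. s i * abs_square (ip v (p i)))"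
    and t: "t \<ge> 0" and I: "I \<subseteq> {..<d}"
  shows "(\<Sum>i\<in>I. a i - b i) \<le> real (card I) * t + (\<Sum>i<d. max 0 (s i - t) * norm_square (Q (p i)))"
proof -
  define n where "n = dim (UNIV :: 'v set)"
  define g where "g i = max 0 (s i - t)" for i
  have g0: "g i \<ge> 0" for i by (simp add: g_def)
  define G where "G v = (\<Sum>i<d. scale (of_real (g i) * ip v (p i)) (p i))" for v
  have "d \<le> n"
    using dim_subset[of X UNIV] onb_dim[OF eigenbasis_onb[OF x(1)]] by (simp only: n_def) simp
  note sQ = projector_self_adjoint[OF Q]
  note sX = projector_self_adjoint[OF projector_orth_proj[OF X]]
    and sY = projector_self_adjoint[OF projector_orth_proj[OF Y]]
  have quad_sandwich: "quad (Q \<circ> A \<circ> Q) v = quad A (Q v)" for A v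
    by (simp add: quad_def self_adjointD[OF sQ])
  have G: "self_adjoint G"
    unfolding self_adjoint_def G_def
    by (simp add: ip_simps conjugate_dist_mul flip: ip_conjugate[of "p _"]) (simp add: ac_simps)
  have "ip (G v) v = (\<Sum>i<d. of_real (g i) * (ip v (p i) * conjugate (ip v (p i))))" for v
    by (simp add: G_def ip_simps mult.assoc flip: ip_conjugate[of "p _"])
  then have quad_G: "quad G v = (\<Sum>i<d. g i * abs_square (ip v (p i)))" for v
    by (simp add: quad_def real_part_sum abs_square_def)
  obtain e where e: "eigenbasis (Q \<circ> orth_proj X \<circ> Q) UNIV n e (\<lambda>i. if i < d then a i else 0)"
    using compression_swap[OF X Q x] unfolding n_def by blast
  obtain f where f: "eigenbasis (Q \<circ> orth_proj Y \<circ> Q) UNIV n f (\<lambda>i. if i < d then b i else 0)"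
    using compression_swap[OF Y Q y] unfolding n_def by blast
  have "(\<Sum>i\<in>I. a i - b i) = (\<Sum>i\<in>I. (if i < d then a i else 0) - (if i < d then b i else 0))"
    using I by (intro sum.cong) auto
  also have "\<dots> \<le> real (card I) * t + (\<Sum>i<d. g i * norm_square (Q (p i)))"
  proof (rule lidskii[where C = "Q \<circ> G \<circ> Q", OF _ e _ _ f])
    show "self_adjoint (Q \<circ> orth_proj X \<circ> Q)" "self_adjoint (Q \<circ> orth_proj Y \<circ> Q)"
      "self_adjoint (Q \<circ> G \<circ> Q)"
      using self_adjoint_sandwich sX sY sQ G by blast+
    show "antimono_on {..<n} (\<lambda>i. if i < d then a i else 0)"
      "antimono_on {..<n} (\<lambda>i. if i < d then b i else 0)"
      using eigenvalue_extension_antimono[OF X Q x] eigenvalue_extension_antimono[OF Y Q y] .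
    show "0 \<le> quad (Q \<circ> G \<circ> Q) v" for v
      unfolding quad_sandwich quad_G by (intro sum_nonneg mult_nonneg_nonneg) (simp_all add: g0)
    show "I \<subseteq> {..<n}" using I \<open>d \<le> n\<close> by auto
    show "(\<Sum>j<n. quad (Q \<circ> G \<circ> Q) (h j)) = (\<Sum>i<d. g i * norm_square (Q (p i)))"
      if h: "onb UNIV n h" for h
    proof -
      have "(\<Sum>j<n. quad (Q \<circ> G \<circ> Q) (h j)) = (\<Sum>j<n. \<Sum>i<d. g i * abs_square (ip (Q (p i)) (h j)))"
        by (simp add: quad_sandwich quad_G self_adjointD[OF sQ] abs_square_ip_commute[of "h _"])
      also have "\<dots> = (\<Sum>i<d. g i * (\<Sum>j<n. abs_square (ip (Q (p i)) (h j))))"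
        unfolding sum_distrib_left by (rule sum.swap)
      finally show ?thesis by (simp flip: bessel_eq[OF h])
    qed
    show "quad (Q \<circ> orth_proj X \<circ> Q) v
        \<le> quad (Q \<circ> orth_proj Y \<circ> Q) v + quad (Q \<circ> G \<circ> Q) v + t * norm_square v" for v
    proof -
      have "quad (orth_proj X) (Q v) - quad (orth_proj Y) (Q v)
          = quad (\<lambda>v. orth_proj X v - orth_proj Y v) (Q v)"
        by (simp add: quad_def ip_simps real_part_diff)
      also have "\<dots> \<le> (\<Sum>i<d. s i * abs_square (ip (Q v) (p i)))"
        by (rule p(3))
      \<comment> \<open>\<open>s i\<close> is at most \<open>g i + t\<close>. The part with
        \<open>t\<close> is then bounded by Bessel's inequality, which costs \<open>t\<close> only
        once in the form and not once per index.\<close>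
      also have "\<dots> \<le> (\<Sum>i<d. (g i + t) * abs_square (ip (Q v) (p i)))"
        by (intro sum_mono mult_right_mono) (auto simp: g_def)
      also have "\<dots> = quad G (Q v) + t * (\<Sum>i<d. abs_square (ip (Q v) (p i)))"
        by (simp add: quad_G distrib_right sum.distrib sum_distrib_left)
      also have "(\<Sum>i<d. abs_square (ip (Q v) (p i))) \<le> norm_square (Q v)"
        using bessel_partial(2)[of d p s, OF p(1,2)] by blast
      also have "norm_square (Q v) \<le> norm_square v"
        by (rule projector_norm_le[OF Q])
      finally show ?thesis using t by (simp add: quad_sandwich mult_left_mono)
    qed
  qed
  finally show ?thesis by (simp add: g_def)
qed

text \<open>If the eigenvalues \<open>a i\<close> decrease, then \<open>1 - a i\<close> increase,
  and reversal restores the order that \<open>lidskii\<close> expects. Fixing the indices from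
  \<open>k\<close> on is what \<open>permutes\<close> demands.\<close>

lemma eigenbasis_rev:
  assumes "eigenbasis A S k e l"
  shows "eigenbasis A S k (\<lambda>i. e (if i < k then k - 1 - i else i)) (\<lambda>i. l (if i < k then k - 1 - i else i))"
proof (rule eigenbasis_permute[OF assms])
  show "(\<lambda>i. if i < k then k - 1 - i else i) permutes {..<k}"
    by (rule bij_imp_permutes) (auto intro!: bij_betw_byWitness[where f' = "\<lambda>i. k - 1 - i"])
qed

text \<open>The increasing eigenvalues are compared through \<open>Q\<close>, the decreasing ones through the
  complementary projector \<open>1 - Q\<close>, whose compressions have the eigenvalues \<open>1 - a\<^sub>i\<close>.
  The two resulting traces add up to the trace of the positive part of \<open>D - t\<close>.\<close>

lemma sum_abs_eigenvalue_diff_le: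
  assumes X: "subspace X" and Y: "subspace Y" and Q: "projector Q"
    and x: "eigenbasis (orth_proj X \<circ> Q \<circ> orth_proj X) X d x a" "antimono_on {..<d} a"
    and y: "eigenbasis (orth_proj Y \<circ> Q \<circ> orth_proj Y) Y d y b" "antimono_on {..<d} b"
    and z: "eigenbasis (orth_proj X \<circ> orth_proj Y \<circ> orth_proj X) X d z c"
    and t: "t \<ge> 0" and K: "K \<subseteq> {..<d}"
  shows "(\<Sum>i\<in>K. \<bar>a i - b i\<bar>) \<le> real (card K) * t + (\<Sum>i<d. max 0 (sqrt (1 - c i) - t))"
proof -
  define s where "s i = sqrt (1 - c i)" for i
  obtain p where p:
    "\<And>i j. i < d \<Longrightarrow> j < d \<Longrightarrow> ip (p i) (p j) = (if i = j \<and> s i \<noteq> 0 then 1 else 0)"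
    "\<And>i. i < d \<Longrightarrow> s i = 0 \<Longrightarrow> p i = 0"
    "\<And>v. quad (\<lambda>v. orth_proj X v - orth_proj Y v) v \<le> (\<Sum>i<d. s i * abs_square (ip v (p i)))"
    using projector_difference_le[OF X Y z] unfolding s_def by blast
  have fin: "finite K" using K finite_subset by blast
  define Q' where "Q' v = v - Q v" for v
  have Q': "projector Q'"
    using projector_complement[OF Q] by (simp add: Q'_def[abs_def])
  define r where "r i = (if i < d then d - 1 - i else i)" for i
  have rev: "antimono_on {..<d} (\<lambda>i. 1 - l (r i))" if "antimono_on {..<d} l" for l :: "nat \<Rightarrow> real"
    using monotone_onD[OF that] by (auto simp: monotone_on_def r_def)
  have x': "eigenbasis (orth_proj X \<circ> Q' \<circ> orth_proj X) X d (\<lambda>i. x (r i)) (\<lambda>i. 1 - a (r i))"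
    using eigenbasis_rev[OF compression_complement[OF X Q x(1)]] unfolding Q'_def r_def .
  have y': "eigenbasis (orth_proj Y \<circ> Q' \<circ> orth_proj Y) Y d (\<lambda>i. y (r i)) (\<lambda>i. 1 - b (r i))"
    using eigenbasis_rev[OF compression_complement[OF Y Q y(1)]] unfolding Q'_def r_def .
  define I where "I = {i \<in> K. a i \<ge> b i}"
  define J where "J = {i \<in> K. \<not> a i \<ge> b i}"
  have IJ: "I \<union> J = K" "I \<inter> J = {}" "finite I" "finite J" "I \<subseteq> {..<d}" "J \<subseteq> {..<d}"
    using fin K by (auto simp: I_def J_def)
  have rr: "r (r i) = i" "r i < d" if "i < d" for i using that by (auto simp: r_def)
  have inj: "inj_on r J" using IJ(6) rr by (metis inj_on_inverseI lessThan_iff subsetD)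
  have pythagoras: "(\<Sum>i<d. max 0 (s i - t) * norm_square (Q (p i)))
      + (\<Sum>i<d. max 0 (s i - t) * norm_square (Q' (p i))) = (\<Sum>i<d. max 0 (s i - t) * norm_square (p i))"
    unfolding sum.distrib[symmetric] distrib_left[symmetric] Q'_def projector_pythagoras[OF Q] ..
  have "(\<Sum>i\<in>K. \<bar>a i - b i\<bar>) = (\<Sum>i\<in>I. a i - b i) + (\<Sum>i\<in>J. b i - a i)"
    unfolding IJ(1)[symmetric] sum.union_disjoint[OF IJ(3,4,2)]
    by (intro arg_cong2[where f = "(+)"] sum.cong) (auto simp: I_def J_def)
  \<comment> \<open>A decrease from \<open>b i\<close> to \<open>a i\<close> reversed in sign is an
    increase of complements, \<open>(1 - a i) - (1 - b i)\<close>. Reading it in reversed order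
    replaces \<open>J\<close> by its image under the involution \<open>r\<close>, which has the same
    size.\<close>
  also have "(\<Sum>i\<in>J. b i - a i) = (\<Sum>i\<in>r ` J. (1 - a (r i)) - (1 - b (r i)))"
    unfolding sum.reindex[OF inj] using rr IJ(6) by (intro sum.cong) auto
  also have "\<dots> \<le> real (card (r ` J)) * t + (\<Sum>i<d. max 0 (s i - t) * norm_square (Q' (p i)))"
    by (rule sum_eigenvalue_diff_le[OF X Y Q' x' rev[OF x(2)] y' rev[OF y(2)] p t])
      (use rr IJ(6) in auto)
  also have "(\<Sum>i\<in>I. a i - b i) \<le> real (card I) * t + (\<Sum>i<d. max 0 (s i - t) * norm_square (Q (p i)))"
    by (rule sum_eigenvalue_diff_le[OF X Y Q x y p t IJ(5)])
  also have "real (card I) * t + (\<Sum>i<d. max 0 (s i - t) * norm_square (Q (p i)))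
      + (real (card (r ` J)) * t + (\<Sum>i<d. max 0 (s i - t) * norm_square (Q' (p i))))
    = real (card K) * t + (\<Sum>i<d. max 0 (s i - t) * norm_square (p i))"
    unfolding card_image[OF inj] IJ(1)[symmetric] card_Un_disjoint[OF IJ(3,4,2)]
    using pythagoras by (simp add: algebra_simps)
  \<comment> \<open>Each \<open>p i\<close> is a unit vector or, when \<open>s i = 0\<close>, the
    zero vector.\<close>
  also have "\<dots> \<le> real (card K) * t + (\<Sum>i<d. max 0 (s i - t))"
  proof (intro add_left_mono sum_mono mult_left_le)
    fix i assume "i \<in> {..<d}"
    then show "norm_square (p i) \<le> 1"
      using p(1)[of i i] by (simp add: norm_square_def)
  qed simp
  finally show ?thesis by (simp add: s_def)
qed

section \<open>Principal angles\<close>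

text \<open>Comparing \<open>ip (T v) (f i)\<close> with \<open>ip v (T (f i))\<close> shows that an
  eigenvector for \<open>r\<close> has components only along those \<open>f i\<close> with
  \<open>l i = r\<close>.\<close>

lemma dim_eigenspace:
  assumes T: "self_adjoint T" and f: "eigenbasis T UNIV n f l"
  shows "dim (eigenspace T (of_real r)) = card {i. i < n \<and> l i = r}"
proof (rule dim_unique)
  define B where "B = f ` {i. i < n \<and> l i = r}"
  note o = orthonormal_independent[OF onb_orthonormal[OF eigenbasis_onb[OF f]]]
  show "B \<subseteq> eigenspace T (of_real r)"
    using eigenbasis_eigen[OF f] by (auto simp: B_def eigenspace_def)
  show "independent B"
    by (rule independent_mono[OF o(2)]) (auto simp: B_def)
  show "card B = card {i. i < n \<and> l i = r}"
    unfolding B_def by (rule card_image) (use o(1) in \<open>auto simp: inj_on_def\<close>)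
  show "eigenspace T (of_real r) \<subseteq> span B"
  proof
    fix v assume "v \<in> eigenspace T (of_real r)"
    then have v: "T v = scale (of_real r) v" by (simp add: eigenspace_def)
    have "scale (ip v (f i)) (f i) \<in> span B" if i: "i < n" for i
    proof (cases "l i = r")
      case True
      then show ?thesis using i by (intro span_scale span_base) (auto simp: B_def)
    next
      case False
      have "ip (T v) (f i) = ip v (T (f i))" by (rule self_adjointD[OF T])
      then have "(of_real r - of_real (l i)) * ip v (f i) = 0"
        by (simp add: v eigenbasis_eigen[OF f i] ip_simps algebra_simps)
      then show ?thesis using False by (simp add: span_zero)
    qed
    then have "(\<Sum>i<n. scale (ip v (f i)) (f i)) \<in> span B"
      by (intro span_sum) auto
    then show "v \<in> span B"
      using onb_expansion[OF eigenbasis_onb[OF f], of v] by simp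
  qed
qed

text \<open>The adjoint product collapses to \<open>Q P Q\<close> because \<open>P\<close> is
  idempotent. The definite description is met uniquely: multiplicities at nonnegative values are
  prescribed, those at negative values are 0, and an ordered list is determined by its
  multiset.\<close>

lemma singular_values_eq:
  assumes P: "projector P" and Q: "projector Q"
    and f: "eigenbasis (Q \<circ> P \<circ> Q) UNIV n f l" and l: "antimono_on {..<n} l" "\<And>i. i < n \<Longrightarrow> l i \<ge> 0"
  shows "singular_values (P \<circ> Q) = map (\<lambda>i. sqrt (l i)) [0..<n]"
proof -
  have T: "self_adjoint (Q \<circ> P \<circ> Q)"
    by (rule self_adjoint_sandwich[OF projector_self_adjoint[OF P] projector_self_adjoint[OF Q]])
  have AA: "adjoint (P \<circ> Q) \<circ> (P \<circ> Q) = Q \<circ> P \<circ> Q"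
    by (simp add: adjoint_projectors[OF P Q] fun_eq_iff projector_idem[OF P])
  have dim: "dim (eigenspace (adjoint (P \<circ> Q) \<circ> (P \<circ> Q)) (of_real (\<sigma>\<^sup>2)))
      = count_list (map (\<lambda>i. sqrt (l i)) [0..<n]) \<sigma>" if "\<sigma> \<ge> 0" for \<sigma>
  proof -
    have "l i = \<sigma>\<^sup>2 \<longleftrightarrow> \<sigma> = sqrt (l i)" if "i < n" for i
      using l(2)[OF that] \<open>\<sigma> \<ge> 0\<close> by auto
    then have "{i. i < n \<and> l i = \<sigma>\<^sup>2} = {i. i < n \<and> \<sigma> = map (\<lambda>i. sqrt (l i)) [0..<n] ! i}"
      by auto
    then show ?thesis
      unfolding AA dim_eigenspace[OF T f] count_list_eq_length_filter length_filter_conv_card by simp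
  qed
  show ?thesis
    unfolding singular_values_def
  proof (rule the_equality)
    have "sorted_wrt (\<ge>) (map (\<lambda>i. sqrt (l i)) [0..<n])"
      using monotone_onD[OF l(1)] by (auto simp: sorted_wrt_iff_nth_less)
    then show *: "sorted_wrt (\<ge>) (map (\<lambda>i. sqrt (l i)) [0..<n]) \<and> set (map (\<lambda>i. sqrt (l i)) [0..<n]) \<subseteq> {0..} \<and>
      (\<forall>\<sigma>\<ge>0. count_list (map (\<lambda>i. sqrt (l i)) [0..<n]) \<sigma>
        = dim (eigenspace (adjoint (P \<circ> Q) \<circ> (P \<circ> Q)) (of_real (\<sigma>\<^sup>2))))"
      using l(2) dim by auto
    fix s assume s: "sorted_wrt (\<ge>) s \<and> set s \<subseteq> {0..} \<and>
      (\<forall>\<sigma>\<ge>0. count_list s \<sigma> = dim (eigenspace (adjoint (P \<circ> Q) \<circ> (P \<circ> Q)) (of_real (\<sigma>\<^sup>2))))"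
    have "count_list s \<sigma> = count_list (map (\<lambda>i. sqrt (l i)) [0..<n]) \<sigma>" for \<sigma>
    proof (cases "\<sigma> \<ge> 0")
      case True
      then show ?thesis using s dim by simp
    next
      case False
      then have "\<sigma> \<notin> set s" "\<sigma> \<notin> set (map (\<lambda>i. sqrt (l i)) [0..<n])" using s * by blast+
      then show ?thesis by (metis count_notin)
    qed
    then have "mset (rev s) = mset (rev (map (\<lambda>i. sqrt (l i)) [0..<n]))"
      unfolding multiset_eq_iff count_mset count_list_rev by blast
    moreover have "sorted (rev s)" "sorted (rev (map (\<lambda>i. sqrt (l i)) [0..<n]))"
      using s * by (simp_all add: sorted_wrt_rev)
    ultimately have "rev s = rev (map (\<lambda>i. sqrt (l i)) [0..<n])"
      by (metis properties_for_sort)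
    then show "s = map (\<lambda>i. sqrt (l i)) [0..<n]" by simp
  qed
qed

text \<open>Connects the definition, whose singular values come from an operator on the whole space,
  with the \<open>d\<close> eigenvalues of a compression on \<open>X\<close>. The zeros padded by
  \<open>compression_swap\<close> start at position \<open>d\<close> and are cut off by
  \<open>take\<close>.\<close>

lemma principal_angles_eq:
  assumes X: "subspace X" and Z: "subspace Z"
    and x: "eigenbasis (orth_proj X \<circ> orth_proj Z \<circ> orth_proj X) X d x a" "antimono_on {..<d} a"
  shows "principal_angles X Z = map (\<lambda>i. arccos (sqrt (a i))) [0..<min d (dim Z)]"
proof -
  define n where "n = dim (UNIV :: 'v set)"
  note PX = projector_orth_proj[OF X] and PZ = projector_orth_proj[OF Z]
  have d: "dim X = d" by (rule onb_dim[OF eigenbasis_onb[OF x(1)]])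
  have "d \<le> n"
    using dim_subset[of X UNIV] d by (simp only: n_def) simp
  obtain f where "eigenbasis (orth_proj Z \<circ> orth_proj X \<circ> orth_proj Z) UNIV n f (\<lambda>i. if i < d then a i else 0)"
    using compression_swap[OF X PZ x] unfolding n_def by blast
  then have "singular_values (orth_proj X \<circ> orth_proj Z)
      = map (\<lambda>i. sqrt (if i < d then a i else 0)) [0..<n]"
    by (rule singular_values_eq[OF PX PZ _ eigenvalue_extension_antimono[OF X PZ x]])
      (simp add: compression_eigenvalue_bounds[OF X PZ x(1)])
  then show ?thesis
    using \<open>d \<le> n\<close> by (simp add: principal_angles_def d take_map)
qed

end

section \<open>Weak majorization from thresholded sums\<close>

text \<open>The sum of the \<open>k\<close> largest entries of \<open>w\<close> is \<open>k t + \<Sum>\<^sub>i max 0 (w\<^sub>i - t)\<close> for \<open>t\<close> the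
  \<open>k\<close>-th largest entry.\<close>

lemma weakly_majorizedI:
  assumes len: "length u \<le> length w" and w: "\<And>i. i < length w \<Longrightarrow> w ! i \<ge> 0"
    and le: "\<And>K t. K \<subseteq> {..<length u} \<Longrightarrow> t \<ge> 0 \<Longrightarrow>
      (\<Sum>i\<in>K. u ! i) \<le> real (card K) * t + (\<Sum>i<length w. max 0 (w ! i - t))"
  shows "u \<prec>\<^sub>w w"
proof -
  define n where "n = length w"
  define u' where "u' = pad_zeros n u"
  have len': "length u' = n" using len by (simp add: u'_def pad_zeros_def n_def)
  have u'_nth: "u' ! j = (if j < length u then u ! j else 0)" if "j < n" for j
    using that by (simp add: u'_def pad_zeros_def nth_append)
  obtain p where p: "p permutes {..<n}" "\<And>i. i < n \<Longrightarrow> nonincreasing u' ! i = u' ! p i"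
    using nonincreasing_permutation[of u'] unfolding len' by blast
  obtain q where q: "q permutes {..<n}" "\<And>i. i < n \<Longrightarrow> nonincreasing w ! i = w ! q i"
    using nonincreasing_permutation[of w] unfolding n_def by blast
  have "sum_list (take k (nonincreasing u')) \<le> sum_list (take k (nonincreasing w))"
    if k: "k \<in> {1..n}" for k
  proof -
    have sum_take: "sum_list (take k v) = (\<Sum>i<k. v ! i)" if "length v = n" for v :: "real list"
      using k that by (simp add: sum_list_sum_nth atLeast0LessThan)
    define t where "t = nonincreasing w ! (k - 1)"
    have k1: "k - 1 < n" using k by auto
    then have "q (k - 1) < n" using permutes_in_image[OF q(1), of "k - 1"] by blast
    then have t: "t \<ge> 0" using q(2)[OF k1] w by (simp add: t_def n_def)
    \<comment> \<open>The positions of the \<open>k\<close> largest entries of the padded vector,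
      without the padding. \<open>K\<close> may thus have fewer than \<open>k\<close> elements,
      which is harmless as t >= 0.\<close>
    define K where "K = p ` {..<k} \<inter> {..<length u}"
    have inj: "inj_on p {..<k}" using permutes_inj_on[OF p(1)] .
    have pn: "p i < n" if "i < k" for i using that k permutes_in_image[OF p(1), of i] by simp
    have "(\<Sum>i<k. nonincreasing u' ! i) = (\<Sum>i<k. u' ! p i)"
      using k p(2) by (intro sum.cong) auto
    also have "\<dots> = (\<Sum>j\<in>p ` {..<k}. u' ! j)"
      by (simp add: sum.reindex[OF inj])
    also have "\<dots> = (\<Sum>j\<in>K. u' ! j)"
      using pn unfolding K_def by (intro sum.mono_neutral_right) (auto simp: u'_nth split: if_splits)
    also have "\<dots> = (\<Sum>j\<in>K. u ! j)"
      using pn by (intro sum.cong) (auto simp: K_def u'_nth)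
    also have "\<dots> \<le> real (card K) * t + (\<Sum>i<n. max 0 (w ! i - t))"
      unfolding n_def by (rule le) (simp_all add: K_def t)
    also have "card K \<le> card (p ` {..<k})"
      unfolding K_def by (rule card_mono) auto
    also have "card (p ` {..<k}) = k"
      by (simp add: card_image[OF inj])
    also have "(\<Sum>i<n. max 0 (w ! i - t)) = (\<Sum>i<n. max 0 (nonincreasing w ! i - t))"
      using sum.permute[OF q(1), of "\<lambda>i. max 0 (w ! i - t)"] q(2) by simp
    \<comment> \<open>Entries from position \<open>k\<close> on are at most \<open>t\<close> and
      contribute 0; the first \<open>k\<close> are at least \<open>t\<close>, so there the maximum
      disappears in the next step.\<close>
    also have "\<dots> = (\<Sum>i<k. max 0 (nonincreasing w ! i - t))"
      using k nonincreasing_nth_mono[of "k - 1" _ w] unfolding n_def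
      by (intro sum.mono_neutral_right) (auto simp: t_def)
    also have "\<dots> = (\<Sum>i<k. nonincreasing w ! i - t)"
      using k nonincreasing_nth_mono[of _ "k - 1" w] unfolding n_def
      by (intro sum.cong) (auto simp: t_def max_def)
    also have "real k * t + \<dots> = (\<Sum>i<k. nonincreasing w ! i)"
      by (simp add: sum_subtractf)
    finally show ?thesis
      using sum_take[of "nonincreasing u'"] sum_take[of "nonincreasing w"] t len'
      by (simp add: n_def mult_right_mono)
  qed
  moreover have "pad_zeros n w = w" by (simp add: pad_zeros_def n_def)
  ultimately show ?thesis
    using len by (simp add: weakly_majorized_def Let_def u'_def n_def max_absorb2)
qed

theorem theorem3p3:
  fixes scale :: "'k::real_or_complex \<Rightarrow> 'v::ab_group_add \<Rightarrow> 'v"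
    and ip :: "'v \<Rightarrow> 'v \<Rightarrow> 'k"
    and X Y Z :: "'v set"
  assumes "fin_dim_inner_product_space scale ip"
    and "module.subspace scale X" and "module.subspace scale Y" and "module.subspace scale Z"
    and "vector_space.dim scale X = vector_space.dim scale Y"
  defines "\<Theta> \<equiv> fin_dim_inner_product_space.principal_angles scale ip"
  shows "abs_diff (map (\<lambda>\<theta>. (cos \<theta>)\<^sup>2) (\<Theta> X Z)) (map (\<lambda>\<theta>. (cos \<theta>)\<^sup>2) (\<Theta> Y Z))
           = abs_diff (map (\<lambda>\<theta>. (sin \<theta>)\<^sup>2) (\<Theta> X Z)) (map (\<lambda>\<theta>. (sin \<theta>)\<^sup>2) (\<Theta> Y Z))
       \<and> abs_diff (map (\<lambda>\<theta>. (sin \<theta>)\<^sup>2) (\<Theta> X Z)) (map (\<lambda>\<theta>. (sin \<theta>)\<^sup>2) (\<Theta> Y Z))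
           \<prec>\<^sub>w map sin (\<Theta> X Y)"
proof -
  interpret fin_dim_inner_product_space scale ip by fact
  note X = assms(2) and Y = assms(3) and Z = assms(4)
  define d where "d = dim X"
  have dY: "dim Y = d" using assms(5) by (simp add: d_def)
  note proj = projector_orth_proj
  have sa: "self_adjoint (orth_proj U \<circ> orth_proj V \<circ> orth_proj U)" if "subspace U" "subspace V" for U V
    using self_adjoint_sandwich proj[THEN projector_self_adjoint] that by blast
  have mem: "(orth_proj U \<circ> orth_proj V \<circ> orth_proj U) v \<in> U" if "subspace U" for U V v
    using orth_proj_mem[OF that] by simp
  obtain x a where x: "eigenbasis (orth_proj X \<circ> orth_proj Z \<circ> orth_proj X) X d x a" "antimono_on {..<d} a"
    using spectral_theorem[OF sa[OF X Z] X mem[OF X]] unfolding d_def .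
  obtain y b where y: "eigenbasis (orth_proj Y \<circ> orth_proj Z \<circ> orth_proj Y) Y d y b" "antimono_on {..<d} b"
    using spectral_theorem[OF sa[OF Y Z] Y mem[OF Y]] unfolding dY .
  obtain z c where z: "eigenbasis (orth_proj X \<circ> orth_proj Y \<circ> orth_proj X) X d z c" "antimono_on {..<d} c"
    using spectral_theorem[OF sa[OF X Y] X mem[OF X]] unfolding d_def .
  define m where "m = min d (dim Z)"
  have \<Theta>: "\<Theta> X Z = map (\<lambda>i. arccos (sqrt (a i))) [0..<m]"
    "\<Theta> Y Z = map (\<lambda>i. arccos (sqrt (b i))) [0..<m]"
    "\<Theta> X Y = map (\<lambda>i. arccos (sqrt (c i))) [0..<d]"
    unfolding \<Theta>_def m_def
    using principal_angles_eq[OF X Z x] principal_angles_eq[OF Y Z y] principal_angles_eq[OF X Y z] dY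
    by simp_all
  note bounds = compression_eigenvalue_bounds[OF X proj[OF Z] x(1)]
    compression_eigenvalue_bounds[OF Y proj[OF Z] y(1)]
    compression_eigenvalue_bounds[OF X proj[OF Y] z(1)]
  have cos: "(cos (arccos (sqrt r)))\<^sup>2 = r" if "0 \<le> r" "r \<le> 1" for r
    using that by (subst cos_arccos) (auto intro: order_trans[of _ 0])
  have sin2: "(sin (arccos (sqrt r)))\<^sup>2 = 1 - r" if "0 \<le> r" "r \<le> 1" for r
    using that by (simp add: sin_squared_eq cos)
  have sin: "sin (arccos (sqrt r)) = sqrt (1 - r)" if "0 \<le> r" "r \<le> 1" for r
    using that by (subst sin_arccos) (auto intro: order_trans[of _ 0])
  have "m \<le> d" by (simp add: m_def)
  have 1: "abs_diff (map (\<lambda>\<theta>. (cos \<theta>)\<^sup>2) (\<Theta> X Z)) (map (\<lambda>\<theta>. (cos \<theta>)\<^sup>2) (\<Theta> Y Z))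
      = map (\<lambda>i. \<bar>a i - b i\<bar>) [0..<m]"
    using \<open>m \<le> d\<close> bounds by (auto simp: abs_diff_def \<Theta> cos intro!: nth_equalityI)
  have 2: "abs_diff (map (\<lambda>\<theta>. (sin \<theta>)\<^sup>2) (\<Theta> X Z)) (map (\<lambda>\<theta>. (sin \<theta>)\<^sup>2) (\<Theta> Y Z))
      = map (\<lambda>i. \<bar>a i - b i\<bar>) [0..<m]"
    using \<open>m \<le> d\<close> bounds by (auto simp: abs_diff_def \<Theta> sin2 intro!: nth_equalityI)
  have 3: "map sin (\<Theta> X Y) = map (\<lambda>i. sqrt (1 - c i)) [0..<d]"
    using bounds by (simp add: \<Theta> sin)
  have "map (\<lambda>i. \<bar>a i - b i\<bar>) [0..<m] \<prec>\<^sub>w map (\<lambda>i. sqrt (1 - c i)) [0..<d]"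
  proof (rule weakly_majorizedI)
    fix K :: "nat set" and t :: real
    assume K: "K \<subseteq> {..<length (map (\<lambda>i. \<bar>a i - b i\<bar>) [0..<m])}" and t: "t \<ge> 0"
    \<comment> \<open>There are only \<open>m\<close> angles with \<open>Z\<close>, but the
      eigenvalue bound holds for arbitrary subsets of all \<open>d\<close> indices, so truncating
      the lists merely restricts \<open>K\<close>.\<close>
    then have "K \<subseteq> {..<d}" using \<open>m \<le> d\<close> by auto
    have "(\<Sum>i\<in>K. map (\<lambda>i. \<bar>a i - b i\<bar>) [0..<m] ! i) = (\<Sum>i\<in>K. \<bar>a i - b i\<bar>)"
      using K by (intro sum.cong) auto
    also have "\<dots> \<le> real (card K) * t + (\<Sum>i<d. max 0 (sqrt (1 - c i) - t))"
      by (rule sum_abs_eigenvalue_diff_le[OF X Y proj[OF Z] x y z(1) t \<open>K \<subseteq> {..<d}\<close>])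
    finally show "(\<Sum>i\<in>K. map (\<lambda>i. \<bar>a i - b i\<bar>) [0..<m] ! i) \<le> real (card K) * t
        + (\<Sum>i<length (map (\<lambda>i. sqrt (1 - c i)) [0..<d]). max 0 (map (\<lambda>i. sqrt (1 - c i)) [0..<d] ! i - t))"
      by simp
  qed (use \<open>m \<le> d\<close> bounds in auto)
  then show ?thesis unfolding 1 2 3 by simp
qed

end
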